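(* Let $G$ be a group equipped with a conjugation-invariant norm and let $T\subseteq(0,\infty)$ be a scaling set. Then: (a) $\hat{\mathcal{C}}(G,T)$ is a complete metric space. (b) $\hat{\mathcal{C}}(G,T)$ is a length space.
   Context: Norms. A norm on a group $G$ is a function $\|\cdot\|\colon G\to[0,\infty)$ with $\|g\|=0\iff g=1$, $\|g^{-1}\|=\|g\|$ and $\|gh\|\le\|g\|+\|h\|$; for a pseudonorm one only requires $\|1\|=0$ instead of the first condition. It is conjugation-invariant if $\|hgh^{-1}\|=\|g\|$ for all $g,h$. It induces the bi-invariant (pseudo)metric $d(g,h)=\|g^{-1}h\|$; all metric notions refer to it. The groups $F_{\mathbb{R}}(G)$ and $F(G)$. Let $G$ be a group with a conjugation-invariant norm. $F_{\mathbb{R}}(G)$ is the free product of copies of the additive group $\mathbb{R}$ indexed by the elements $g$ of the set $G$; the element $r$ of the copy indexed by $g$ is written $\overline{g}(r)$. It carries the conjugation-invariant pseudonorm $$\|x\|=\inf\Big\{\sum_{i=1}^n |r_i|\,\|g_i\| : x=\prod_{i=1}^n h_i\,\overline{g_i}(r_i)^{\pm1}h_i^{-1},\ h_i\in F_{\mathbb{R}}(G)\Big\}.$$ $F(G)\le F_{\mathbb{R}}(G)$ is the subgroup generated by the elements $\overline{g}:=\overline{g}(1)$; it is free on $\{\overline{g}: g\in G\}$. For $t\in\mathbb{R}$, $\psi_t\colon F_{\mathbb{R}}(G)\to F_{\mathbb{R}}(G)$ is the homomorphism with $\psi_t(\overline{g}(r))=\overline{g}(tr)$. $\pi\colon F(G)\to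 G$ is the homomorphism with $\pi(\overline{g})=g$. Directional asymptotic cone. A scaling set is an unbounded subset $T\subseteq(0,\infty)$; limits over $t\in T$ are taken as $t\to\infty$. A function $f$ from $T$ to a pseudometric space is Cauchy if for every $\epsilon>0$, $d(f(t),f(t'))<\epsilon$ for all sufficiently large $t,t'\in T$. $\mathcal{D}(G,T)$ is the group (pointwise product) of all functions $w\colon T\to F(G)$ such that $t\mapsto\psi_{1/t}(w(t))\in F_{\mathbb{R}}(G)$ is Cauchy, with pseudonorm $\|w\|=\lim_{t\in T}\|\psi_{1/t}(w(t))\|$. $\mathcal{C}(G,T)=\{\pi\circ w: w\in\mathcal{D}(G,T)\}$, a group of functions $T\to G$, with pseudonorm $\|g\|=\inf\{\|w\|: w\in\mathcal{D}(G,T),\ \pi\circ w=g\}$. The directional asymptotic cone $\hat{\mathcal{C}}(G,T)$ is the quotient of $\mathcal{C}(G,T)$ by the normal subgroup of elements of pseudonorm $0$, with the induced conjugation-invariant norm. A metric space $X$ is a length space if for all $x,y\in X$ and every $\epsilon>0$ there is a path from $x$ to $y$ of length less than $d(x,y)+\epsilon$. *)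

theory Defs
  imports "HOL-Algebra.Elementary_Groups" "HOL-Algebra.Product_Groups" "HOL-Analysis.Analysis"
begin

section \<open>Groups with a conjugation-invariant norm\<close>

locale conj_inv_normed_group = group G for G (structure) +
  fixes N :: "'a \<Rightarrow> real"
  assumes norm_nonneg: "g \<in> carrier G \<Longrightarrow> 0 \<le> N g"
    and norm_eq_zero_iff: "g \<in> carrier G \<Longrightarrow> N g = 0 \<longleftrightarrow> g = \<one>"
    and norm_inv: "g \<in> carrier G \<Longrightarrow> N (inv g) = N g"
    and norm_mult_le: "g \<in> carrier G \<Longrightarrow> h \<in> carrier G \<Longrightarrow> N (g \<otimes> h) \<le> N g + N h"
    and norm_conj: "g \<in> carrier G \<Longrightarrow> h \<in> carrier G \<Longrightarrow> N (h \<otimes> g \<otimes> inv h) = N g"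

text \<open>The distance is set to \<open>0\<close> off the carrier because the locale \<^locale>\<open>Metric_space\<close>
  requires non-negativity and symmetry for all arguments.\<close>

definition norm_dist :: "('a, 'b) monoid_scheme \<Rightarrow> ('a \<Rightarrow> real) \<Rightarrow> 'a \<Rightarrow> 'a \<Rightarrow> real" where
  "norm_dist G N x y =
     (if x \<in> carrier G \<and> y \<in> carrier G then N (inv\<^bsub>G\<^esub> x \<otimes>\<^bsub>G\<^esub> y) else 0)"


section \<open>Free products of groups\<close>

definition fp_words :: "'i set \<Rightarrow> ('i \<Rightarrow> ('b, 'c) monoid_scheme) \<Rightarrow> ('i \<times> 'b) list set" where
  "fp_words I H = lists (SIGMA i:I. carrier (H i))"

inductive_set fp_rel ::
    "'i set \<Rightarrow> ('i \<Rightarrow> ('b, 'c) monoid_scheme) \<Rightarrow> (('i \<times> 'b) list \<times> ('i \<times> 'b) list) set"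
  for I H where
    refl: "w \<in> fp_words I H \<Longrightarrow> (w, w) \<in> fp_rel I H"
  | sym: "(v, w) \<in> fp_rel I H \<Longrightarrow> (w, v) \<in> fp_rel I H"
  | trans: "(u, v) \<in> fp_rel I H \<Longrightarrow> (v, w) \<in> fp_rel I H \<Longrightarrow> (u, w) \<in> fp_rel I H"
  | unit: "u \<in> fp_words I H \<Longrightarrow> v \<in> fp_words I H \<Longrightarrow> i \<in> I
      \<Longrightarrow> (u @ [(i, \<one>\<^bsub>H i\<^esub>)] @ v, u @ v) \<in> fp_rel I H"
  | merge: "u \<in> fp_words I H \<Longrightarrow> v \<in> fp_words I H \<Longrightarrow> i \<in> I
      \<Longrightarrow> a \<in> carrier (H i) \<Longrightarrow> b \<in> carrier (H i)
      \<Longrightarrow> (u @ [(i, a), (i, b)] @ v, u @ [(i, a \<otimes>\<^bsub>H i\<^esub> b)] @ v) \<in> fp_rel I H"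

definition free_product ::
    "'i set \<Rightarrow> ('i \<Rightarrow> ('b, 'c) monoid_scheme) \<Rightarrow> ('i \<times> 'b) list set monoid" where
  "free_product I H =
     \<lparr>carrier = fp_words I H // fp_rel I H,
      monoid.mult = (\<lambda>X Y. \<Union>x\<in>X. \<Union>y\<in>Y. fp_rel I H `` {x @ y}),
      one = fp_rel I H `` {[]}\<rparr>"

definition fp_incl :: "'i set \<Rightarrow> ('i \<Rightarrow> ('b, 'c) monoid_scheme) \<Rightarrow> 'i \<Rightarrow> 'b \<Rightarrow> ('i \<times> 'b) list set" where
  "fp_incl I H i a = fp_rel I H `` {[(i, a)]}"


section \<open>The groups \<open>F\<^sub>\<real>(G)\<close> and \<open>F(G)\<close>\<close>

definition real_add_group :: "real monoid" where
  "real_add_group = \<lparr>carrier = UNIV, monoid.mult = (+), one = 0\<rparr>"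

definition FR :: "('a, 'b) monoid_scheme \<Rightarrow> ('a \<times> real) list set monoid" where
  "FR G = free_product (carrier G) (\<lambda>_. real_add_group)"

definition FR_bar :: "('a, 'b) monoid_scheme \<Rightarrow> 'a \<Rightarrow> real \<Rightarrow> ('a \<times> real) list set" where
  "FR_bar G g r = fp_incl (carrier G) (\<lambda>_. real_add_group) g r"

text \<open>A list entry \<open>(h, g, r, e)\<close> stands for the factor \<open>h \<cdot> g(r)\<^sup>e \<cdot> h\<^sup>-\<^sup>1\<close>.\<close>

definition FR_conj_prod ::
    "('a, 'b) monoid_scheme \<Rightarrow> (('a \<times> real) list set \<times> 'a \<times> real \<times> int) list
      \<Rightarrow> ('a \<times> real) list set" where
  "FR_conj_prod G fs =
     foldr (\<otimes>\<^bsub>FR G\<^esub>)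
       (map (\<lambda>(h, g, r, e). h \<otimes>\<^bsub>FR G\<^esub> (FR_bar G g r [^]\<^bsub>FR G\<^esub> e) \<otimes>\<^bsub>FR G\<^esub> inv\<^bsub>FR G\<^esub> h) fs)
       \<one>\<^bsub>FR G\<^esub>"

definition FR_norm ::
    "('a, 'b) monoid_scheme \<Rightarrow> ('a \<Rightarrow> real) \<Rightarrow> ('a \<times> real) list set \<Rightarrow> real" where
  "FR_norm G N x =
     Inf {(\<Sum>(h, g, r, e)\<leftarrow>fs. \<bar>r\<bar> * N g) | fs.
            fs \<in> lists (carrier (FR G) \<times> carrier G \<times> UNIV \<times> {1, - 1}) \<and>
            x = FR_conj_prod G fs}"

definition FZ :: "('a, 'b) monoid_scheme \<Rightarrow> ('a \<times> real) list set monoid" where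
  "FZ G = subgroup_generated (FR G) {FR_bar G g 1 | g. g \<in> carrier G}"

text \<open>In the next two definitions the homomorphism exists and is unique by the universal property of
  the free product and by freeness of \<open>F(G)\<close>; extensionality fixes its values off the carrier.\<close>

definition FR_psi ::
    "('a, 'b) monoid_scheme \<Rightarrow> real \<Rightarrow> ('a \<times> real) list set \<Rightarrow> ('a \<times> real) list set" where
  "FR_psi G t =
     (THE f. f \<in> extensional (carrier (FR G)) \<and> f \<in> hom (FR G) (FR G) \<and>
             (\<forall>g\<in>carrier G. \<forall>r. f (FR_bar G g r) = FR_bar G g (t * r)))"

definition FZ_pi :: "('a, 'b) monoid_scheme \<Rightarrow> ('a \<times> real) list set \<Rightarrow> 'a" where
  "FZ_pi G =
     (THE f. f \<in> extensional (carrier (FZ G)) \<and> f \<in> hom (FZ G) G \<and>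
             (\<forall>g\<in>carrier G. f (FR_bar G g 1) = g))"


section \<open>The directional asymptotic cone\<close>

definition scaling_set :: "real set \<Rightarrow> bool" where
  "scaling_set T \<longleftrightarrow> T \<subseteq> {0<..} \<and> \<not> bounded T"

definition cauchy_along :: "real set \<Rightarrow> ('p \<Rightarrow> 'p \<Rightarrow> real) \<Rightarrow> (real \<Rightarrow> 'p) \<Rightarrow> bool" where
  "cauchy_along T d f \<longleftrightarrow>
     (\<forall>\<epsilon>>0. \<exists>t0. \<forall>t\<in>T. \<forall>t'\<in>T. t \<ge> t0 \<longrightarrow> t' \<ge> t0 \<longrightarrow> d (f t) (f t') < \<epsilon>)"

definition dir_D ::
    "('a, 'b) monoid_scheme \<Rightarrow> ('a \<Rightarrow> real) \<Rightarrow> real set \<Rightarrow> (real \<Rightarrow> ('a \<times> real) list set) monoid" where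
  "dir_D G N T =
     (product_group T (\<lambda>_. FZ G))
       \<lparr>carrier := {w \<in> carrier (product_group T (\<lambda>_. FZ G)).
          cauchy_along T (norm_dist (FR G) (FR_norm G N)) (\<lambda>t. FR_psi G (1 / t) (w t))}\<rparr>"

definition dir_D_norm ::
    "('a, 'b) monoid_scheme \<Rightarrow> ('a \<Rightarrow> real) \<Rightarrow> real set \<Rightarrow> (real \<Rightarrow> ('a \<times> real) list set) \<Rightarrow> real" where
  "dir_D_norm G N T w =
     Lim (inf at_top (principal T)) (\<lambda>t. FR_norm G N (FR_psi G (1 / t) (w t)))"

definition dir_C ::
    "('a, 'b) monoid_scheme \<Rightarrow> ('a \<Rightarrow> real) \<Rightarrow> real set \<Rightarrow> (real \<Rightarrow> 'a) monoid" where
  "dir_C G N T =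
     (product_group T (\<lambda>_. G))
       \<lparr>carrier := {compose T (FZ_pi G) w | w. w \<in> carrier (dir_D G N T)}\<rparr>"

definition dir_C_norm ::
    "('a, 'b) monoid_scheme \<Rightarrow> ('a \<Rightarrow> real) \<Rightarrow> real set \<Rightarrow> (real \<Rightarrow> 'a) \<Rightarrow> real" where
  "dir_C_norm G N T g =
     Inf {dir_D_norm G N T w | w. w \<in> carrier (dir_D G N T) \<and> compose T (FZ_pi G) w = g}"

definition dir_cone ::
    "('a, 'b) monoid_scheme \<Rightarrow> ('a \<Rightarrow> real) \<Rightarrow> real set \<Rightarrow> (real \<Rightarrow> 'a) set monoid" where
  "dir_cone G N T =
     dir_C G N T Mod {g \<in> carrier (dir_C G N T). dir_C_norm G N T g = 0}"

text \<open>\<^const>\<open>dir_C_norm\<close> is constant on each coset.\<close>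

definition dir_cone_norm ::
    "('a, 'b) monoid_scheme \<Rightarrow> ('a \<Rightarrow> real) \<Rightarrow> real set \<Rightarrow> (real \<Rightarrow> 'a) set \<Rightarrow> real" where
  "dir_cone_norm G N T X = the_elem (dir_C_norm G N T ` X)"

definition dir_cone_dist ::
    "('a, 'b) monoid_scheme \<Rightarrow> ('a \<Rightarrow> real) \<Rightarrow> real set
      \<Rightarrow> (real \<Rightarrow> 'a) set \<Rightarrow> (real \<Rightarrow> 'a) set \<Rightarrow> real" where
  "dir_cone_dist G N T = norm_dist (dir_cone G N T) (dir_cone_norm G N T)"


section \<open>Length spaces\<close>

definition path_length :: "('p \<Rightarrow> 'p \<Rightarrow> real) \<Rightarrow> (real \<Rightarrow> 'p) \<Rightarrow> ereal" where
  "path_length d \<gamma> =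
     (SUP ts \<in> {ts. sorted ts \<and> set ts \<subseteq> {0..1}}.
        ereal (\<Sum>i<length ts - 1. d (\<gamma> (ts ! i)) (\<gamma> (ts ! Suc i))))"

definition length_space :: "'p set \<Rightarrow> ('p \<Rightarrow> 'p \<Rightarrow> real) \<Rightarrow> bool" where
  "length_space M d \<longleftrightarrow>
     Metric_space M d \<and>
     (\<forall>x\<in>M. \<forall>y\<in>M. \<forall>\<epsilon>>0. \<exists>\<gamma>. pathin (Metric_space.mtopology M d) \<gamma> \<and>
        \<gamma> 0 = x \<and> \<gamma> 1 = y \<and> path_length d \<gamma> < ereal (d x y + \<epsilon>))"

end

theory Submission
  imports Defs "HOL-Algebra.Bij"
begin

text \<open>
  The directional asymptotic cone is a quotient of \<open>D(G,T)\<close>: the pseudonorm on \<open>C(G,T)\<close> is the infimum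
  of the pseudonorms of lifts to \<open>D(G,T)\<close>, and passing to the cone only removes the elements of
  pseudonorm zero. So every element of the cone of norm \<open>< c\<close> is the image of an element of \<open>D(G,T)\<close> of
  pseudonorm \<open>< c\<close>. This is the notion \<open>norm_quotient_map\<close>, and two properties descend along
  such maps, because they only ask for elements of small norm to be lifted: convergence of infinite
  products \<open>u\<^sub>0 u\<^sub>1 u\<^sub>2 \<dots>\<close> with \<open>\<parallel>u\<^sub>n\<parallel> < 2\<^sup>-\<^sup>n\<close> (\<open>fast_products_converge\<close>), and existence
  of paths from \<open>1\<close> to a point close to a given \<open>w\<close>, with Lipschitz constant close to \<open>\<parallel>w\<parallel>\<close>
  (\<open>has_almost_geodesics\<close>). For a genuine norm the first property is completeness of
  the metric. Given completeness, the second one gives a length space: if the path ends at \<open>\<gamma>\<^sub>0(1)\<close>,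
  treat the small error \<open>\<gamma>\<^sub>0(1)\<^sup>-\<^sup>1 w\<close> in the same way, iterate, and multiply all the paths pointwise;
  bi-invariance makes Lipschitz constants of products add up
  (\<open>exists_Lipschitz_path_from_one\<close>).

  It remains to verify both properties for \<open>D(G,T)\<close>. Products converge by a diagonal argument: take
  at time \<open>t\<close> a partial product whose length \<open>k(t)\<close> grows slowly enough
  (\<open>D_fast_products_converge\<close>). For the paths, an element \<open>w\<close> of \<open>D(G,T)\<close> is close to the
  single element \<open>x = \<psi>\<^sub>1\<^sub>/\<^sub>t w(t)\<close> of \<open>F\<^sub>\<real>(G)\<close> for any large \<open>t\<close>. Write \<open>x\<close> as a product of conjugates of
  \<open>g\<^sub>i(r\<^sub>i)\<^sup>\<plusminus>\<^sup>1\<close> with \<open>\<Sum> \<bar>r\<^sub>i\<bar> \<parallel>g\<^sub>i\<parallel>\<close> close to \<open>\<parallel>x\<parallel>\<close> and replace each \<open>r\<^sub>i\<close> by \<open>s r\<^sub>i\<close>, \<open>0 \<le> s \<le> 1\<close>: this is a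
  path of the required speed from \<open>1\<close> to \<open>x\<close> in \<open>F\<^sub>\<real>(G)\<close>. Finally \<open>F\<^sub>\<real>(G)\<close> maps to \<open>D(G,T)\<close> by
  replacing each \<open>g(r)\<close> at time \<open>t\<close> with the element \<open>g(\<lfloor>t r\<rfloor>)\<close> of \<open>F(G)\<close>
  (\<open>FR_approximable\<close>).

  The homomorphisms \<open>\<psi>\<^sub>t\<close> and \<open>\<pi>\<close> are given by definite descriptions, so their existence has to be
  proved. For \<open>\<psi>\<^sub>t\<close> this is the universal property of the free product. The map \<open>\<pi>\<close> does not extend to
  a homomorphism from \<open>F\<^sub>\<real>(G)\<close> to \<open>G\<close> in general, since an element of \<open>G\<close> need not have roots. Instead of normal
  forms in the free product, the proof uses an action of \<open>F\<^sub>\<real>(G)\<close> on \<open>G \<times> [0,1)\<close> from which \<open>\<pi>\<close> can be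
  read off (\<open>FZ_pi_exists\<close>).
\<close>

section \<open>Groups with a conjugation-invariant pseudonorm\<close>

locale conj_inv_pseudonormed_group = group G for G (structure) +
  fixes N :: "'a \<Rightarrow> real"
  assumes pnorm_nonneg: "g \<in> carrier G \<Longrightarrow> 0 \<le> N g"
    and pnorm_one: "N \<one> = 0"
    and pnorm_inv: "g \<in> carrier G \<Longrightarrow> N (inv g) = N g"
    and pnorm_mult_le: "g \<in> carrier G \<Longrightarrow> h \<in> carrier G \<Longrightarrow> N (g \<otimes> h) \<le> N g + N h"
    and pnorm_conj: "g \<in> carrier G \<Longrightarrow> h \<in> carrier G \<Longrightarrow> N (h \<otimes> g \<otimes> inv h) = N g"

sublocale conj_inv_normed_group \<subseteq> conj_inv_pseudonormed_group
  by unfold_locales (auto simp: norm_nonneg norm_eq_zero_iff norm_inv norm_mult_le norm_conj)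

context conj_inv_pseudonormed_group
begin

abbreviation dist_N :: "'a \<Rightarrow> 'a \<Rightarrow> real" where "dist_N \<equiv> norm_dist G N"

lemma dist_eq: "x \<in> carrier G \<Longrightarrow> y \<in> carrier G \<Longrightarrow> dist_N x y = N (inv x \<otimes> y)"
  by (simp add: norm_dist_def)

lemma dist_nonneg: "0 \<le> dist_N x y"
  by (simp add: norm_dist_def pnorm_nonneg)

lemma dist_self: "dist_N x x = 0"
  by (simp add: norm_dist_def pnorm_one)

lemma dist_commute: "dist_N x y = dist_N y x"
  using pnorm_inv[of "inv x \<otimes> y"] by (auto simp: norm_dist_def inv_mult_group)

lemma dist_triangle:
  assumes "x \<in> carrier G" "y \<in> carrier G" "z \<in> carrier G"
  shows "dist_N x z \<le> dist_N x y + dist_N y z"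
proof -
  have "inv x \<otimes> z = (inv x \<otimes> y) \<otimes> (inv y \<otimes> z)"
    using assms by (metis inv_closed inv_solve_left m_assoc m_closed)
  then show ?thesis using pnorm_mult_le[of "inv x \<otimes> y" "inv y \<otimes> z"] assms by (simp add: dist_eq)
qed

lemma dist_left_mult:
  assumes "c \<in> carrier G" "x \<in> carrier G" "y \<in> carrier G"
  shows "dist_N (c \<otimes> x) (c \<otimes> y) = dist_N x y"
proof -
  have "inv (c \<otimes> x) \<otimes> (c \<otimes> y) = inv x \<otimes> y"
    using assms by (metis inv_closed inv_mult_group inv_solve_left m_assoc m_closed)
  then show ?thesis using assms by (simp add: dist_eq)
qed

lemma dist_right_mult:
  assumes "c \<in> carrier G" "x \<in> carrier G" "y \<in> carrier G"
  shows "dist_N (x \<otimes> c) (y \<otimes> c) = dist_N x y"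
proof -
  have "inv (x \<otimes> c) \<otimes> (y \<otimes> c) = inv c \<otimes> (inv x \<otimes> y) \<otimes> inv (inv c)"
    using assms by (simp add: inv_mult_group m_assoc)
  then show ?thesis using assms pnorm_conj[of "inv x \<otimes> y" "inv c"] by (simp add: dist_eq)
qed

text \<open>By bi-invariance one factor of a product can be changed at a time. This is why Lipschitz paths
  may be multiplied pointwise, with the Lipschitz constants adding up.\<close>

lemma dist_mult_le:
  assumes "a \<in> carrier G" "b \<in> carrier G" "c \<in> carrier G" "d \<in> carrier G"
  shows "dist_N (a \<otimes> b) (c \<otimes> d) \<le> dist_N a c + dist_N b d"
  using dist_triangle[of "a \<otimes> b" "c \<otimes> b" "c \<otimes> d"] dist_right_mult[of b a c]
    dist_left_mult[of c b d] assms by simp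

lemma dist_inv_inv:
  assumes "x \<in> carrier G" "y \<in> carrier G"
  shows "dist_N (inv x) (inv y) = dist_N x y"
proof -
  have "x \<otimes> inv y = x \<otimes> (inv y \<otimes> x) \<otimes> inv x"
    using assms by (simp add: m_assoc)
  then have "dist_N (inv x) (inv y) = dist_N y x"
    using assms pnorm_conj[of "inv y \<otimes> x" x] by (simp add: dist_eq)
  then show ?thesis by (simp add: dist_commute)
qed

lemma dist_one_left: "x \<in> carrier G \<Longrightarrow> dist_N \<one> x = N x"
  by (simp add: dist_eq)

lemma norm_diff_le_dist:
  assumes "x \<in> carrier G" "y \<in> carrier G"
  shows "\<bar>N x - N y\<bar> \<le> dist_N x y"
  using dist_triangle[of \<one> x y] dist_triangle[of \<one> y x] assms dist_commute[of x y]
  by (simp add: dist_one_left)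

lemma norm_mult_null_left:
  assumes "k \<in> carrier G" "N k = 0" "g \<in> carrier G"
  shows "N (k \<otimes> g) = N g"
proof -
  have "N (inv k \<otimes> (k \<otimes> g)) \<le> N (inv k) + N (k \<otimes> g)"
    by (rule pnorm_mult_le) (use assms in auto)
  moreover have "inv k \<otimes> (k \<otimes> g) = g" using assms by (metis inv_closed l_inv l_one m_assoc)
  ultimately show ?thesis using pnorm_mult_le[of k g] assms by (simp add: pnorm_inv)
qed

definition null_elements where "null_elements = {g \<in> carrier G. N g = 0}"

lemma mem_null_elements: "g \<in> null_elements \<longleftrightarrow> g \<in> carrier G \<and> N g = 0"
  by (simp add: null_elements_def)

lemma null_elements_normal: "null_elements \<lhd> G"
proof -
  have "subgroup null_elements G"
    by (rule subgroupI)
      (auto simp: null_elements_def pnorm_inv norm_mult_null_left intro: pnorm_one)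
  then show ?thesis
    by (auto simp: normal_inv_iff null_elements_def pnorm_conj)
qed

text \<open>Multiplication by an element of pseudonorm zero does not change the pseudonorm, so the image of
  a coset is a singleton.\<close>

lemma norm_image_coset:
  assumes "g \<in> carrier G"
  shows "the_elem (N ` (null_elements #> g)) = N g"
proof -
  have "\<one> \<in> null_elements" by (simp add: null_elements_def pnorm_one)
  moreover have "N ` (null_elements #> g) = (\<lambda>_. N g) ` null_elements"
    unfolding r_coset_def
    using assms by (force simp: null_elements_def norm_mult_null_left image_iff)
  ultimately have "N ` (null_elements #> g) = {N g}" by auto
  then show ?thesis by simp
qed

lemma quotient_conj_inv_normed_group:
  "conj_inv_normed_group (G Mod null_elements) (\<lambda>X. the_elem (N ` X))"
proof -
  have one_Mod: "\<one>\<^bsub>G Mod null_elements\<^esub> = null_elements" by (simp add: FactGroup_def)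
  interpret K: normal null_elements G by (rule null_elements_normal)
  interpret Q: group "G Mod null_elements" by (rule K.factorgroup_is_group)
  have rep: "\<exists>g\<in>carrier G. X = null_elements #> g" if "X \<in> carrier (G Mod null_elements)" for X
    using that by (auto simp: FactGroup_def RCOSETS_def)
  have inv: "inv\<^bsub>G Mod null_elements\<^esub> (null_elements #> g) = null_elements #> inv g"
    if "g \<in> carrier G" for g
  proof -
    have "null_elements #> g \<in> carrier (G Mod null_elements)"
      using that by (auto simp: FactGroup_def RCOSETS_def)
    then show ?thesis using that by (simp add: K.inv_FactGroup K.rcos_inv)
  qed
  have mult: "(null_elements #> g) \<otimes>\<^bsub>G Mod null_elements\<^esub> (null_elements #> h) = null_elements #> (g \<otimes> h)"
    if "g \<in> carrier G" "h \<in> carrier G" for g h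
    using that by (simp add: FactGroup_def K.rcos_sum)
  have zero: "N g = 0 \<longleftrightarrow> null_elements #> g = \<one>\<^bsub>G Mod null_elements\<^esub>" if "g \<in> carrier G" for g
  proof -
    have "null_elements #> g = null_elements \<longleftrightarrow> g \<in> null_elements"
    proof
      show "g \<in> null_elements" if "null_elements #> g = null_elements"
        by (rule coset_join1[OF that \<open>g \<in> carrier G\<close> K.subgroup_axioms])
      show "null_elements #> g = null_elements" if "g \<in> null_elements"
        by (rule coset_join2[OF \<open>g \<in> carrier G\<close> K.subgroup_axioms that])
    qed
    then show ?thesis unfolding one_Mod using that mem_null_elements by metis
  qed
  show ?thesis
  proof unfold_locales
    fix X assume "X \<in> carrier (G Mod null_elements)"
    then obtain g where g: "g \<in> carrier G" "X = null_elements #> g" using rep by blast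
    show "0 \<le> the_elem (N ` X)" using g by (simp add: norm_image_coset pnorm_nonneg)
    show "the_elem (N ` X) = 0 \<longleftrightarrow> X = \<one>\<^bsub>G Mod null_elements\<^esub>"
      using g zero by (simp add: norm_image_coset)
    show "the_elem (N ` (inv\<^bsub>G Mod null_elements\<^esub> X)) = the_elem (N ` X)"
      using g by (simp add: inv norm_image_coset pnorm_inv)
    fix Y assume "Y \<in> carrier (G Mod null_elements)"
    then obtain h where h: "h \<in> carrier G" "Y = null_elements #> h" using rep by blast
    show "the_elem (N ` (X \<otimes>\<^bsub>G Mod null_elements\<^esub> Y)) \<le> the_elem (N ` X) + the_elem (N ` Y)"
      using g h by (simp add: K.rcos_sum norm_image_coset pnorm_mult_le)
    show "the_elem (N ` (Y \<otimes>\<^bsub>G Mod null_elements\<^esub> X \<otimes>\<^bsub>G Mod null_elements\<^esub> inv\<^bsub>G Mod null_elements\<^esub> Y))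
        = the_elem (N ` X)"
      using g h by (simp add: K.rcos_sum inv norm_image_coset pnorm_conj)
  qed
qed

end

section \<open>Norm quotient maps\<close>

text \<open>Equivalently, for every \<open>c\<close> the open ball of radius \<open>c\<close> about the identity is mapped onto the
  open ball of radius \<open>c\<close>.\<close>

definition norm_quotient_map ::
  "('a, 'c) monoid_scheme \<Rightarrow> ('a \<Rightarrow> real) \<Rightarrow> ('b, 'd) monoid_scheme \<Rightarrow> ('b \<Rightarrow> real) \<Rightarrow> ('a \<Rightarrow> 'b) \<Rightarrow> bool" where
  "norm_quotient_map G N H M q \<longleftrightarrow> q \<in> hom G H \<and> (\<forall>w\<in>carrier G. M (q w) \<le> N w) \<and>
     (\<forall>h\<in>carrier H. \<forall>c. M h < c \<longrightarrow> (\<exists>w\<in>carrier G. q w = h \<and> N w < c))"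

lemma norm_quotient_map_comp:
  assumes "norm_quotient_map G N H M p" "norm_quotient_map H M K L q"
  shows "norm_quotient_map G N K L (q \<circ> p)"
  unfolding norm_quotient_map_def
proof (intro conjI ballI allI impI)
  show "q \<circ> p \<in> hom G K"
    using assms by (auto simp: norm_quotient_map_def intro: Group.hom_compose)
next
  fix w assume "w \<in> carrier G"
  then show "L ((q \<circ> p) w) \<le> N w"
    using assms order_trans[of "L (q (p w))" "M (p w)" "N w"]
    by (auto simp: norm_quotient_map_def dest: hom_in_carrier)
next
  fix k c assume "k \<in> carrier K" "L k < c"
  then show "\<exists>w\<in>carrier G. (q \<circ> p) w = k \<and> N w < c"
    using assms unfolding norm_quotient_map_def comp_def by metis
qed

lemma (in conj_inv_pseudonormed_group) norm_quotient_map_coset: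
  "norm_quotient_map G N (G Mod null_elements) (\<lambda>X. the_elem (N ` X)) (\<lambda>g. null_elements #> g)"
  unfolding norm_quotient_map_def
proof (intro conjI ballI allI impI)
  show "(\<lambda>g. null_elements #> g) \<in> hom G (G Mod null_elements)"
    by (rule normal.r_coset_hom_Mod[OF null_elements_normal])
qed (auto simp: norm_image_coset FactGroup_def RCOSETS_def)

text \<open>The target inherits each axiom from almost optimal lifts; lifting the conjugating element as
  well gives conjugation invariance.\<close>

lemma (in conj_inv_pseudonormed_group) infimum_norm:
  assumes "group H" "q \<in> hom G H" "q ` carrier G = carrier H"
  defines "M \<equiv> (\<lambda>h. Inf {N w | w. w \<in> carrier G \<and> q w = h})"
  shows infimum_norm_quotient_map: "norm_quotient_map G N H M q"
    and infimum_norm_pseudonormed: "conj_inv_pseudonormed_group H M"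
proof -
  interpret H: group H by fact
  interpret q: group_hom G H q by unfold_locales (fact assms)
  have bdd: "bdd_below {N w | w. w \<in> carrier G \<and> q w = h}" for h
    by (rule bdd_belowI[of _ 0]) (auto simp: pnorm_nonneg)
  have le: "M (q w) \<le> N w" if "w \<in> carrier G" for w
    unfolding M_def using that by (intro cInf_lower bdd) auto
  have less: "\<exists>w\<in>carrier G. q w = h \<and> N w < c" if "h \<in> carrier H" "M h < c" for h c
  proof -
    have "h \<in> q ` carrier G" using that assms(3) by simp
    then have ne: "{N w | w. w \<in> carrier G \<and> q w = h} \<noteq> {}" by auto
    have "Inf {N w | w. w \<in> carrier G \<and> q w = h} < c" using that(2) unfolding M_def .
    from cInf_lessD[OF ne this] show ?thesis by blast
  qed
  show "norm_quotient_map G N H M q"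
    unfolding norm_quotient_map_def
  proof (intro conjI ballI allI impI)
    show "q \<in> hom G H" by fact
  qed (rule le less, assumption+)+
  have nonneg: "0 \<le> M h" if "h \<in> carrier H" for h
    using less[OF that, of 0] pnorm_nonneg by (meson linorder_not_less)
  have inv_le: "M (inv\<^bsub>H\<^esub> h) \<le> M h" if h: "h \<in> carrier H" for h
  proof (rule dense_ge)
    fix c assume "M h < c"
    then obtain w where w: "w \<in> carrier G" "q w = h" "N w < c" using less[OF h] by blast
    then show "M (inv\<^bsub>H\<^esub> h) \<le> c" using le[of "inv w"] by (simp add: pnorm_inv q.hom_inv)
  qed
  have conj_le: "M (k \<otimes>\<^bsub>H\<^esub> h \<otimes>\<^bsub>H\<^esub> inv\<^bsub>H\<^esub> k) \<le> M h" if h: "h \<in> carrier H" and k: "k \<in> carrier H" for h k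
  proof (rule dense_ge)
    fix c assume "M h < c"
    then obtain w where w: "w \<in> carrier G" "q w = h" "N w < c" using less[OF h] by blast
    have "k \<in> q ` carrier G" using k assms(3) by simp
    then obtain v where v: "v \<in> carrier G" "q v = k" by blast
    show "M (k \<otimes>\<^bsub>H\<^esub> h \<otimes>\<^bsub>H\<^esub> inv\<^bsub>H\<^esub> k) \<le> c"
      using le[of "v \<otimes> w \<otimes> inv v"] w v by (simp add: pnorm_conj)
  qed
  show "conj_inv_pseudonormed_group H M"
  proof unfold_locales
    show "M \<one>\<^bsub>H\<^esub> = 0" using le[of \<one>] nonneg[of "\<one>\<^bsub>H\<^esub>"] by (simp add: pnorm_one)
  next
    fix h assume "h \<in> carrier H"
    then show "M (inv\<^bsub>H\<^esub> h) = M h"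
      using inv_le[of h] inv_le[of "inv\<^bsub>H\<^esub> h"] by simp
  next
    fix g h assume gh: "g \<in> carrier H" "h \<in> carrier H"
    show "M (g \<otimes>\<^bsub>H\<^esub> h) \<le> M g + M h"
    proof (rule field_le_epsilon)
      fix e :: real assume "e > 0"
      obtain v where v: "v \<in> carrier G" "q v = g" "N v < M g + e/2"
        using less[OF gh(1), of "M g + e/2"] \<open>e > 0\<close> by auto
      obtain w where w: "w \<in> carrier G" "q w = h" "N w < M h + e/2"
        using less[OF gh(2), of "M h + e/2"] \<open>e > 0\<close> by auto
      show "M (g \<otimes>\<^bsub>H\<^esub> h) \<le> M g + M h + e"
        using le[of "v \<otimes> w"] pnorm_mult_le[of v w] v w by simp
    qed
  next
    fix h k assume hk: "h \<in> carrier H" "k \<in> carrier H"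
    have "inv\<^bsub>H\<^esub> k \<otimes>\<^bsub>H\<^esub> (k \<otimes>\<^bsub>H\<^esub> h \<otimes>\<^bsub>H\<^esub> inv\<^bsub>H\<^esub> k) \<otimes>\<^bsub>H\<^esub> inv\<^bsub>H\<^esub> (inv\<^bsub>H\<^esub> k)
        = (inv\<^bsub>H\<^esub> k \<otimes>\<^bsub>H\<^esub> k) \<otimes>\<^bsub>H\<^esub> h \<otimes>\<^bsub>H\<^esub> (inv\<^bsub>H\<^esub> k \<otimes>\<^bsub>H\<^esub> k)"
      using hk by (simp only: H.m_assoc H.m_closed H.inv_closed H.inv_inv)
    then have "inv\<^bsub>H\<^esub> k \<otimes>\<^bsub>H\<^esub> (k \<otimes>\<^bsub>H\<^esub> h \<otimes>\<^bsub>H\<^esub> inv\<^bsub>H\<^esub> k) \<otimes>\<^bsub>H\<^esub> inv\<^bsub>H\<^esub> (inv\<^bsub>H\<^esub> k) = h"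
      using hk by (simp only: H.l_inv H.l_one H.r_one)
    then show "M (k \<otimes>\<^bsub>H\<^esub> h \<otimes>\<^bsub>H\<^esub> inv\<^bsub>H\<^esub> k) = M h"
      using conj_le[OF hk] conj_le[of "k \<otimes>\<^bsub>H\<^esub> h \<otimes>\<^bsub>H\<^esub> inv\<^bsub>H\<^esub> k" "inv\<^bsub>H\<^esub> k"] hk by simp
  qed (fact nonneg)
qed

section \<open>Convergence of fast products and almost geodesics\<close>

primrec partial_prod :: "('a, 'b) monoid_scheme \<Rightarrow> (nat \<Rightarrow> 'a) \<Rightarrow> nat \<Rightarrow> 'a" where
  "partial_prod G u 0 = \<one>\<^bsub>G\<^esub>"
| "partial_prod G u (Suc n) = partial_prod G u n \<otimes>\<^bsub>G\<^esub> u n"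

lemma (in group) partial_prod_closed:
  "(\<And>n. u n \<in> carrier G) \<Longrightarrow> partial_prod G u n \<in> carrier G"
  by (induction n) auto

lemma partial_prod_hom:
  assumes "group G" "group H" "q \<in> hom G H" "\<And>n. u n \<in> carrier G"
  shows "q (partial_prod G u n) = partial_prod H (\<lambda>n. q (u n)) n"
proof -
  interpret q: group_hom G H q using assms by (simp add: group_hom_def group_hom_axioms_def)
  show ?thesis using assms(4) by (induction n) (auto simp: q.G.partial_prod_closed)
qed

text \<open>Completeness in a form that descends along norm quotient maps: the strict bound on a factor is
  exactly what allows it to be lifted with the same bound. The limit is in general
  unique only up to pseudonorm zero.\<close>

definition fast_products_converge :: "('a, 'b) monoid_scheme \<Rightarrow> ('a \<Rightarrow> real) \<Rightarrow> bool" where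
  "fast_products_converge G N \<longleftrightarrow>
     (\<forall>u. (\<forall>n. u n \<in> carrier G \<and> N (u n) < (1/2)^n) \<longrightarrow>
        (\<exists>x\<in>carrier G. (\<lambda>n. norm_dist G N (partial_prod G u n) x) \<longlonglongrightarrow> 0))"

text \<open>The end point of the path is only required to be close to \<open>w\<close>. In \<open>D(G,T)\<close> paths
  are easy to find only for a dense set of end points, and completeness closes the gap later.\<close>

definition has_almost_geodesics :: "('a, 'b) monoid_scheme \<Rightarrow> ('a \<Rightarrow> real) \<Rightarrow> bool" where
  "has_almost_geodesics G N \<longleftrightarrow>
     (\<forall>w\<in>carrier G. \<forall>\<epsilon>>0. \<exists>\<gamma> L. \<gamma> \<in> {0..1} \<rightarrow> carrier G \<and> N (\<gamma> 0) = 0 \<and>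
        (\<forall>s\<in>{0..1::real}. \<forall>s'\<in>{0..1}. norm_dist G N (\<gamma> s) (\<gamma> s') \<le> L * \<bar>s - s'\<bar>) \<and>
        L < N w + \<epsilon> \<and> norm_dist G N (\<gamma> 1) w < \<epsilon>)"

lemma norm_quotient_map_dist_le:
  assumes "group G" "group H" "norm_quotient_map G N H M q" "x \<in> carrier G" "y \<in> carrier G"
  shows "norm_dist H M (q x) (q y) \<le> norm_dist G N x y"
proof -
  interpret q: group_hom G H q
    using assms by (simp add: group_hom_def group_hom_axioms_def norm_quotient_map_def)
  have "q (inv\<^bsub>G\<^esub> x \<otimes>\<^bsub>G\<^esub> y) = inv\<^bsub>H\<^esub> (q x) \<otimes>\<^bsub>H\<^esub> q y" using assms by simp
  moreover have "M (q (inv\<^bsub>G\<^esub> x \<otimes>\<^bsub>G\<^esub> y)) \<le> N (inv\<^bsub>G\<^esub> x \<otimes>\<^bsub>G\<^esub> y)"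
    using assms(3-5) q.G.m_closed[of "inv\<^bsub>G\<^esub> x" y] by (auto simp: norm_quotient_map_def simp del: q.G.m_closed q.hom_mult)
  ultimately show ?thesis using assms by (simp add: norm_dist_def)
qed

lemma fast_products_converge_quotient:
  assumes "conj_inv_pseudonormed_group G N" "conj_inv_pseudonormed_group H M"
    "norm_quotient_map G N H M q" "fast_products_converge G N"
  shows "fast_products_converge H M"
  unfolding fast_products_converge_def
proof (intro allI impI)
  interpret G: conj_inv_pseudonormed_group G N by fact
  interpret H: conj_inv_pseudonormed_group H M by fact
  interpret q: group_hom G H q
    using assms by unfold_locales (simp add: norm_quotient_map_def)
  fix u assume u: "\<forall>n. u n \<in> carrier H \<and> M (u n) < (1/2)^n"
  have "\<forall>n. \<exists>v\<in>carrier G. q v = u n \<and> N v < (1/2)^n"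
    using u assms(3) by (simp add: norm_quotient_map_def)
  then obtain v where v: "\<And>n. v n \<in> carrier G" "\<And>n. q (v n) = u n" "\<And>n. N (v n) < (1/2)^n"
    by metis
  obtain x where x: "x \<in> carrier G" "(\<lambda>n. norm_dist G N (partial_prod G v n) x) \<longlonglongrightarrow> 0"
    using assms(4) v unfolding fast_products_converge_def by metis
  have "norm_dist H M (partial_prod H u n) (q x) \<le> norm_dist G N (partial_prod G v n) x" for n
    using norm_quotient_map_dist_le[OF _ _ assms(3), of "partial_prod G v n" x]
      partial_prod_hom[of G H q v n] v x G.partial_prod_closed[of v n]
    by (simp add: G.is_group H.is_group q.homh)
  then have "(\<lambda>n. norm_dist H M (partial_prod H u n) (q x)) \<longlonglongrightarrow> 0"
    by (intro tendsto_sandwich[OF _ _ tendsto_const x(2)]) (auto simp: H.dist_nonneg)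
  then show "\<exists>x\<in>carrier H. (\<lambda>n. norm_dist H M (partial_prod H u n) x) \<longlonglongrightarrow> 0"
    using x(1) by auto
qed

lemma has_almost_geodesics_quotient:
  assumes "conj_inv_pseudonormed_group G N" "conj_inv_pseudonormed_group H M"
    "norm_quotient_map G N H M q" "has_almost_geodesics G N"
  shows "has_almost_geodesics H M"
  unfolding has_almost_geodesics_def
proof (intro ballI allI impI)
  interpret G: conj_inv_pseudonormed_group G N by fact
  interpret H: conj_inv_pseudonormed_group H M by fact
  interpret q: group_hom G H q
    using assms by unfold_locales (simp add: norm_quotient_map_def)
  fix h \<epsilon> assume h: "h \<in> carrier H" and "\<epsilon> > (0::real)"
  then obtain w where w: "w \<in> carrier G" "q w = h" "N w < M h + \<epsilon>/2"
    using assms(3) unfolding norm_quotient_map_def by (meson half_gt_zero less_add_same_cancel1)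
  obtain \<gamma> L where g: "\<gamma> \<in> {0..1} \<rightarrow> carrier G" "N (\<gamma> 0) = 0"
      "\<And>s s'. s \<in> {0..1::real} \<Longrightarrow> s' \<in> {0..1} \<Longrightarrow> norm_dist G N (\<gamma> s) (\<gamma> s') \<le> L * \<bar>s - s'\<bar>"
      "L < N w + \<epsilon>/2" "norm_dist G N (\<gamma> 1) w < \<epsilon>/2"
    using assms(4)[unfolded has_almost_geodesics_def, rule_format, OF w(1) half_gt_zero[OF \<open>\<epsilon> > 0\<close>]]
    by blast
  have gc: "\<gamma> s \<in> carrier G" if "s \<in> {0..1}" for s using g(1) that by auto
  have le: "norm_dist H M (q x) (q y) \<le> norm_dist G N x y" if "x \<in> carrier G" "y \<in> carrier G" for x y
    using norm_quotient_map_dist_le[OF G.is_group H.is_group assms(3) that] .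
  show "\<exists>\<gamma> L. \<gamma> \<in> {0..1} \<rightarrow> carrier H \<and> M (\<gamma> 0) = 0 \<and>
        (\<forall>s\<in>{0..1::real}. \<forall>s'\<in>{0..1}. norm_dist H M (\<gamma> s) (\<gamma> s') \<le> L * \<bar>s - s'\<bar>) \<and>
        L < M h + \<epsilon> \<and> norm_dist H M (\<gamma> 1) h < \<epsilon>"
  proof (intro exI[of _ "\<lambda>s. q (\<gamma> s)"] exI[of _ L] conjI ballI)
    show "(\<lambda>s. q (\<gamma> s)) \<in> {0..1} \<rightarrow> carrier H" using gc by auto
    have "M (q (\<gamma> 0)) \<le> N (\<gamma> 0)" using gc assms(3) by (simp add: norm_quotient_map_def)
    then show "M (q (\<gamma> 0)) = 0" using g(2) H.pnorm_nonneg[of "q (\<gamma> 0)"] gc[of 0] by simp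
    show "norm_dist H M (q (\<gamma> s)) (q (\<gamma> s')) \<le> L * \<bar>s - s'\<bar>" if "s \<in> {0..1}" "s' \<in> {0..1}" for s s'
      using le[OF gc gc] g(3) that by (meson order_trans)
    show "L < M h + \<epsilon>" using g(4) w(3) by simp
    show "norm_dist H M (q (\<gamma> 1)) h < \<epsilon>"
      using le[OF gc w(1), of 1] g(5) w(2) \<open>\<epsilon> > 0\<close> by simp
  qed
qed

section \<open>Completeness and the length space property\<close>

lemma (in conj_inv_normed_group) Metric_space_norm_dist: "Metric_space (carrier G) (norm_dist G N)"
proof
  show "norm_dist G N x y = 0 \<longleftrightarrow> x = y" if "x \<in> carrier G" "y \<in> carrier G" for x y
    using that by (metis dist_eq inv_closed inv_equality inv_inv m_closed norm_eq_zero_iff r_inv)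
qed (auto simp: dist_nonneg dist_commute intro: dist_triangle)

lemma (in Metric_space) MCauchy_if_geometric:
  assumes "range \<sigma> \<subseteq> M" "\<And>n. d (\<sigma> n) (\<sigma> (Suc n)) \<le> C * (1/2)^n"
  shows "MCauchy \<sigma>"
proof -
  have M: "\<sigma> n \<in> M" for n using assms(1) by auto
  have tail: "d (\<sigma> m) (\<sigma> (m + k)) \<le> 2 * C * (1/2)^m - 2 * C * (1/2)^(m+k)" for m k
  proof (induction k)
    case (Suc k)
    have "d (\<sigma> m) (\<sigma> (m + Suc k)) \<le> d (\<sigma> m) (\<sigma> (m+k)) + d (\<sigma> (m+k)) (\<sigma> (Suc (m+k)))"
      using triangle M by simp
    then show ?case using Suc assms(2)[of "m+k"] by simp
  qed (simp add: M)
  have C: "0 \<le> C" using order_trans[OF nonneg assms(2)[of 0]] by simp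
  have tail': "d (\<sigma> m) (\<sigma> n) \<le> 2 * C * (1/2)^m" if "m \<le> n" for m n
  proof -
    have "0 \<le> 2 * C * (1/2)^n" using C by simp
    then show ?thesis using tail[of m "n - m"] that by simp
  qed
  have lim: "(\<lambda>m. 2 * C * (1/2)^m :: real) \<longlonglongrightarrow> 0"
    by (intro tendsto_mult_right_zero LIMSEQ_realpow_zero) auto
  show ?thesis
    unfolding MCauchy_def
  proof (intro conjI allI impI)
    fix \<epsilon> :: real assume "\<epsilon> > 0"
    then obtain K where K: "\<And>m. m \<ge> K \<Longrightarrow> 2 * C * (1/2)^m < \<epsilon>"
      using order_tendstoD(2)[OF lim] by (auto simp: eventually_sequentially)
    have "d (\<sigma> m) (\<sigma> n) < \<epsilon>" if "m \<ge> K" "n \<ge> K" for m n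
      using tail'[of m n] tail'[of n m] K[of m] K[of n] that commute[of "\<sigma> m" "\<sigma> n"]
      by (cases "m \<le> n") auto
    then show "\<exists>K. \<forall>m n. K \<le> m \<longrightarrow> K \<le> n \<longrightarrow> d (\<sigma> m) (\<sigma> n) < \<epsilon>" by blast
  qed fact
qed

text \<open>A Cauchy sequence has a subsequence \<open>x\<^sub>n\<close> with \<open>\<parallel>x\<^sub>n\<^sup>-\<^sup>1 x\<^sub>n\<^sub>+\<^sub>1\<parallel> < 2\<^sup>-\<^sup>n\<close>, and \<open>x\<^sub>n\<close> is \<open>x\<^sub>0\<close> times the
  partial products of these quotients.\<close>

lemma (in conj_inv_normed_group) mcomplete_if_fast_products_converge:
  assumes "fast_products_converge G N"
  shows "Metric_space.mcomplete (carrier G) (norm_dist G N)"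
proof -
  interpret M: Metric_space "carrier G" "norm_dist G N" by (rule Metric_space_norm_dist)
  show ?thesis
    unfolding M.mcomplete_def
  proof (intro allI impI)
    fix \<sigma> assume \<sigma>: "M.MCauchy \<sigma>"
    then have c: "\<sigma> n \<in> carrier G" for n by (auto simp: M.MCauchy_def)
    have "\<forall>n. \<exists>K. \<forall>m m'. K \<le> m \<longrightarrow> K \<le> m' \<longrightarrow> norm_dist G N (\<sigma> m) (\<sigma> m') < (1/2)^n"
      using \<sigma> by (simp add: M.MCauchy_def)
    then obtain K where K: "\<And>n m m'. K n \<le> m \<Longrightarrow> K n \<le> m' \<Longrightarrow> norm_dist G N (\<sigma> m) (\<sigma> m') < (1/2)^n"
      by metis
    define r where "r n = n + (\<Sum>i\<le>n. K i)" for n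
    have r: "strict_mono r" by (rule strict_monoI_Suc) (simp add: r_def)
    have rK: "K n \<le> r n" for n
      unfolding r_def by (meson atMost_iff finite_atMost le0 member_le_sum order.refl trans_le_add2)
    define u where "u n = inv (\<sigma> (r n)) \<otimes> \<sigma> (r (Suc n))" for n
    have "N (u n) < (1/2)^n" for n
      using K[OF rK[of n], of "r (Suc n)"] rK[of n] strict_mono_leD[OF r, of n "Suc n"] c
      by (simp add: u_def dist_eq)
    moreover have u: "u n \<in> carrier G" for n by (simp add: u_def c)
    ultimately obtain x where x: "x \<in> carrier G"
        "(\<lambda>n. norm_dist G N (partial_prod G u n) x) \<longlonglongrightarrow> 0"
      using assms unfolding fast_products_converge_def by blast
    have prod: "\<sigma> (r n) = \<sigma> (r 0) \<otimes> partial_prod G u n" for n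
    proof (induction n)
      case (Suc n)
      have "\<sigma> (r 0) \<otimes> partial_prod G u (Suc n) = \<sigma> (r n) \<otimes> u n"
        by (simp add: Suc u c partial_prod_closed m_assoc)
      also have "\<dots> = \<sigma> (r (Suc n))" by (simp add: u_def c m_assoc[symmetric])
      finally show ?case by simp
    qed (simp add: c)
    have "norm_dist G N (\<sigma> (r n)) (\<sigma> (r 0) \<otimes> x) = norm_dist G N (partial_prod G u n) x" for n
      using dist_left_mult[of "\<sigma> (r 0)" "partial_prod G u n" x] x u c prod[of n]
      by (simp add: partial_prod_closed)
    then have "limitin M.mtopology (\<sigma> \<circ> r) (\<sigma> (r 0) \<otimes> x) sequentially"
      using x c by (simp add: M.limitin_metric_dist_null)
    then show "\<exists>x. limitin M.mtopology \<sigma> x sequentially"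
      using M.MCauchy_convergent_subsequence[OF \<sigma> r] by blast
  qed
qed

lemma path_length_le_Lipschitz:
  assumes "\<And>s s'. s \<in> {0..1} \<Longrightarrow> s' \<in> {0..1} \<Longrightarrow> d (\<gamma> s) (\<gamma> s') \<le> L * \<bar>s - s'\<bar>" "0 \<le> L"
  shows "path_length d \<gamma> \<le> ereal L"
  unfolding path_length_def
proof (rule SUP_least)
  fix ts :: "real list" assume "ts \<in> {ts. sorted ts \<and> set ts \<subseteq> {0..1}}"
  then have ts: "sorted ts" "\<And>i. i < length ts \<Longrightarrow> ts ! i \<in> {0..1}" by (auto dest: nth_mem)
  have "(\<Sum>i<length ts - 1. d (\<gamma> (ts ! i)) (\<gamma> (ts ! Suc i)))
      \<le> (\<Sum>i<length ts - 1. L * (ts ! Suc i - ts ! i))"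
  proof (rule sum_mono)
    fix i assume "i \<in> {..<length ts - 1}"
    then have i: "Suc i < length ts" by simp
    then have "ts ! i \<le> ts ! Suc i" using ts(1) by (simp add: sorted_nth_mono)
    then show "d (\<gamma> (ts ! i)) (\<gamma> (ts ! Suc i)) \<le> L * (ts ! Suc i - ts ! i)"
      using assms(1)[OF ts(2) ts(2), of i "Suc i"] i by simp
  qed
  also have "\<dots> = L * (ts ! (length ts - 1) - ts ! 0)"
    by (simp add: sum_distrib_left[symmetric] sum_lessThan_telescope)
  also have "\<dots> \<le> L"
  proof (cases "ts = []")
    case False
    then have "ts ! (length ts - 1) - ts ! 0 \<le> 1"
      using ts(2)[of 0] ts(2)[of "length ts - 1"] by simp
    then show ?thesis using mult_left_mono[OF _ \<open>0 \<le> L\<close>] by fastforce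
  qed (use \<open>0 \<le> L\<close> in simp)
  finally show "ereal (\<Sum>i<length ts - 1. d (\<gamma> (ts ! i)) (\<gamma> (ts ! Suc i))) \<le> ereal L" by simp
qed

lemma (in Metric_space) pathin_if_Lipschitz:
  assumes "\<And>s. s \<in> {0..1} \<Longrightarrow> \<gamma> s \<in> M"
    "\<And>s s'. s \<in> {0..1} \<Longrightarrow> s' \<in> {0..1} \<Longrightarrow> d (\<gamma> s) (\<gamma> s') \<le> L * \<bar>s - s'\<bar>"
  shows "pathin mtopology \<gamma>"
proof -
  have "continuous_map (top_of_set {0..1}) mtopology \<gamma>"
    unfolding continuous_map_to_metric
  proof (intro ballI allI impI)
    fix s :: real and \<epsilon> :: real
    assume "s \<in> topspace (top_of_set {0..1})" "\<epsilon> > 0"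
    then have s: "s \<in> {0..1}" by simp
    let ?U = "{0..1} \<inter> ball s (\<epsilon> / (\<bar>L\<bar> + 1))"
    have "\<gamma> y \<in> mball (\<gamma> s) \<epsilon>" if "y \<in> ?U" for y
    proof -
      have y: "y \<in> {0..1}" "\<bar>s - y\<bar> * (\<bar>L\<bar> + 1) < \<epsilon>"
        using that by (auto simp: dist_real_def field_simps)
      have "d (\<gamma> s) (\<gamma> y) \<le> L * \<bar>s - y\<bar>" using assms(2) s y(1) by blast
      also have "\<dots> \<le> (\<bar>L\<bar> + 1) * \<bar>s - y\<bar>" by (intro mult_right_mono) auto
      finally show ?thesis using y assms(1)[OF s] assms(1)[OF y(1)] by (simp add: mult.commute)
    qed
    moreover have "openin (top_of_set {0..1}) ?U" by (simp add: openin_open_Int)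
    moreover have "s \<in> ?U" using s \<open>\<epsilon> > 0\<close> by simp
    ultimately show "\<exists>U. openin (top_of_set {0..1}) U \<and> s \<in> U \<and> (\<forall>y\<in>U. \<gamma> y \<in> mball (\<gamma> s) \<epsilon>)"
      by blast
  qed
  then show ?thesis by (simp add: pathin_def)
qed

lemma (in conj_inv_normed_group) dist_partial_prod_le:
  assumes "\<And>n. u n \<in> carrier G" "\<And>n. v n \<in> carrier G"
  shows "norm_dist G N (partial_prod G u n) (partial_prod G v n) \<le> (\<Sum>i<n. norm_dist G N (u i) (v i))"
proof (induction n)
  case (Suc n)
  then show ?case
    using dist_mult_le[of "partial_prod G u n" "u n" "partial_prod G v n" "v n"] assms
    by (simp add: partial_prod_closed)
qed (simp add: dist_self)

text \<open>Correct the end point of an almost geodesic again and again: \<open>g n\<close> is an almost geodesic for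
  the remaining error \<open>W n\<close>, where \<open>W 0 = z\<close> and \<open>W (n + 1) = (g n 1)\<^sup>-\<^sup>1 W n\<close>, so that
  \<open>z = g 0 1 \<cdot> g 1 1 \<cdots> g (n - 1) 1 \<cdot> W n\<close>. The errors are chosen to decrease geometrically, hence so do
  the Lipschitz constants, and the infinite pointwise product of the \<open>g n\<close> is a path ending at \<open>z\<close> itself.\<close>

lemma (in conj_inv_normed_group) exists_Lipschitz_path_from_one:
  assumes complete: "Metric_space.mcomplete (carrier G) (norm_dist G N)"
    and approx: "has_almost_geodesics G N" and z: "z \<in> carrier G" and "\<epsilon> > 0"
  obtains \<gamma> L where "\<And>s. s \<in> {0..1} \<Longrightarrow> \<gamma> s \<in> carrier G" "\<gamma> 0 = \<one>" "\<gamma> 1 = z"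
    "\<And>s s'. s \<in> {0..1::real} \<Longrightarrow> s' \<in> {0..1} \<Longrightarrow> norm_dist G N (\<gamma> s) (\<gamma> s') \<le> L * \<bar>s - s'\<bar>"
    "L < N z + \<epsilon>"
proof -
  interpret M: Metric_space "carrier G" "norm_dist G N" by (rule Metric_space_norm_dist)
  define good where "good w e \<gamma> L \<longleftrightarrow> \<gamma> \<in> {0..1} \<rightarrow> carrier G \<and> N (\<gamma> 0) = 0 \<and>
        (\<forall>s\<in>{0..1::real}. \<forall>s'\<in>{0..1}. norm_dist G N (\<gamma> s) (\<gamma> s') \<le> L * \<bar>s - s'\<bar>) \<and>
        L < N w + e \<and> norm_dist G N (\<gamma> 1) w < e" for w e \<gamma> L
  have step: "\<exists>\<gamma> L. good w e \<gamma> L" if "w \<in> carrier G" "e > 0" for w e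
    unfolding good_def
    using approx[unfolded has_almost_geodesics_def, rule_format, OF that] by simp
  define \<Gamma> where "\<Gamma> w e = (SOME \<gamma>. \<exists>L. good w e \<gamma> L)" for w e
  define \<Lambda> where "\<Lambda> w e = (SOME L. good w e (\<Gamma> w e) L)" for w e
  have \<Gamma>: "good w e (\<Gamma> w e) (\<Lambda> w e)" if "w \<in> carrier G" "e > 0" for w e
  proof -
    have "\<exists>L. good w e (\<Gamma> w e) L" unfolding \<Gamma>_def by (rule someI_ex[OF step[OF that]])
    then show ?thesis unfolding \<Lambda>_def by (rule someI_ex)
  qed
  \<comment> \<open>The Lipschitz constant of \<open>g 0\<close> is below \<open>N z + e 0\<close>, that of \<open>g (n + 1)\<close> below \<open>e n + e (n + 1)\<close>. As the \<open>e n\<close> sum up to \<open>2 c\<close>, the total stays below \<open>N z + 4 c\<close>.\<close>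
  define c where "c = \<epsilon> / 8"
  define e where "e n = c * (1/2)^n" for n :: nat
  have c: "c > 0" using \<open>\<epsilon> > 0\<close> by (simp add: c_def)
  have e: "e n > 0" for n using c by (simp add: e_def)
  define W where "W = rec_nat z (\<lambda>n w. inv (\<Gamma> w (e n) 1) \<otimes> w)"
  define g where "g n = \<Gamma> (W n) (e n)" for n
  define l where "l n = \<Lambda> (W n) (e n)" for n
  have W_0: "W 0 = z" and W_Suc: "W (Suc n) = inv (g n 1) \<otimes> W n" for n
    by (simp_all add: W_def g_def)
  have W: "W n \<in> carrier G" for n
  proof (induction n)
    case (Suc n)
    then have "g n 1 \<in> carrier G" using \<Gamma>[OF Suc e[of n]] by (auto simp: good_def g_def)
    then show ?case using Suc by (simp add: W_Suc)
  qed (simp add: W_0 z)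
  have gl: "good (W n) (e n) (g n) (l n)" for n
    unfolding g_def l_def by (rule \<Gamma>[OF W e])
  have gc: "g n s \<in> carrier G" if "s \<in> {0..1}" for n s
    using gl[of n] that by (auto simp: good_def)
  have g0: "g n 0 = \<one>" for n
    using gl[of n] gc[of 0 n] norm_eq_zero_iff[of "g n 0"] by (simp add: good_def)
  have g_lip: "norm_dist G N (g n s) (g n s') \<le> l n * \<bar>s - s'\<bar>" if "s \<in> {0..1}" "s' \<in> {0..1}" for n s s'
    using gl[of n] that by (simp add: good_def)
  have l_less: "l n < N (W n) + e n" for n using gl[of n] by (simp add: good_def)
  have N_W: "N (W (Suc n)) < e n" for n
    using gl[of n] gc[of 1 n] W[of n] by (simp add: good_def dist_eq W_Suc)
  have l_nonneg: "0 \<le> l n" for n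
    using order_trans[OF dist_nonneg g_lip[of 0 1 n]] by simp
  have sum_l: "(\<Sum>i<Suc n. l i) \<le> N z + 4 * c - 3 * c * (1/2)^n" for n
  proof (induction n)
    case 0
    then show ?case using l_less[of 0] by (simp add: W_0 e_def)
  next
    case (Suc n)
    have "l (Suc n) \<le> e n + e (Suc n)" using l_less[of "Suc n"] N_W[of n] by simp
    then show ?case using Suc by (simp add: e_def field_simps)
  qed
  define L where "L = N z + 4 * c"
  have sum_l': "(\<Sum>i<n. l i) \<le> L" for n
  proof -
    have "(\<Sum>i<n. l i) \<le> (\<Sum>i<Suc n. l i)" using l_nonneg by simp
    also have "\<dots> \<le> L - 3 * c * (1/2)^n" using sum_l[of n] by (simp add: L_def)
    also have "\<dots> \<le> L" using c by simp
    finally show ?thesis .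
  qed
  have l_geom: "l n \<le> (N z + 3 * c) * (1/2)^n" for n
  proof (cases n)
    case 0
    then show ?thesis using l_less[of 0] c by (simp add: W_0 e_def)
  next
    case (Suc m)
    have "l n \<le> 3 * c * (1/2)^n" using l_less[of n] N_W[of m] Suc by (simp add: e_def field_simps)
    also have "\<dots> \<le> (N z + 3 * c) * (1/2)^n"
      by (intro mult_right_mono) (auto simp: norm_nonneg z)
    finally show ?thesis .
  qed
  define P where "P s n = partial_prod G (\<lambda>n. g n s) n" for s n
  have P: "P s n \<in> carrier G" if "s \<in> {0..1}" for s n
    unfolding P_def by (rule partial_prod_closed) (rule gc[OF that])
  have "\<exists>x. limitin M.mtopology (P s) x sequentially" if s: "s \<in> {0..1}" for s
  proof -
    have "norm_dist G N (P s n) (P s (Suc n)) \<le> (N z + 3 * c) * (1/2)^n" for n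
    proof -
      have "norm_dist G N (P s n) (P s (Suc n)) = norm_dist G N \<one> (g n s)"
        using dist_left_mult[of "P s n" \<one> "g n s"] P[OF s] gc[OF s] by (simp add: P_def)
      also have "\<dots> \<le> l n * s" using g_lip[of 0 s n] s by (simp add: g0)
      also have "\<dots> \<le> l n" using s l_nonneg[of n] by (simp add: mult_left_le)
      finally show ?thesis using l_geom[of n] by simp
    qed
    moreover have "range (P s) \<subseteq> carrier G" using P[OF s] by auto
    ultimately have "M.MCauchy (P s)" by (intro M.MCauchy_if_geometric) auto
    then show ?thesis using complete unfolding M.mcomplete_def by blast
  qed
  then obtain \<gamma> where lim: "\<And>s. s \<in> {0..1} \<Longrightarrow> limitin M.mtopology (P s) (\<gamma> s) sequentially"
    by metis
  have \<gamma>: "\<gamma> s \<in> carrier G" if "s \<in> {0..1}" for s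
    using M.limitin_mspace[OF lim[OF that]] .
  have lim0: "(\<lambda>n. norm_dist G N (P s n) (\<gamma> s)) \<longlonglongrightarrow> 0" if "s \<in> {0..1}" for s
    using lim[OF that] by (simp add: M.limitin_metric_dist_null)
  have lip: "norm_dist G N (\<gamma> s) (\<gamma> s') \<le> L * \<bar>s - s'\<bar>" if s: "s \<in> {0..1}" "s' \<in> {0..1}" for s s'
  proof (rule LIMSEQ_le_const)
    show "(\<lambda>n. norm_dist G N (P s n) (\<gamma> s) + L * \<bar>s - s'\<bar> + norm_dist G N (P s' n) (\<gamma> s'))
        \<longlonglongrightarrow> L * \<bar>s - s'\<bar>"
      using tendsto_add[OF tendsto_add[OF lim0[OF s(1)] tendsto_const] lim0[OF s(2)]] by simp
    have "norm_dist G N (\<gamma> s) (\<gamma> s') \<le> norm_dist G N (P s n) (\<gamma> s) + L * \<bar>s - s'\<bar>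
        + norm_dist G N (P s' n) (\<gamma> s')" for n
    proof -
      have "norm_dist G N (P s n) (P s' n) \<le> (\<Sum>i<n. norm_dist G N (g i s) (g i s'))"
        unfolding P_def by (rule dist_partial_prod_le) (use gc s in auto)
      also have "\<dots> \<le> (\<Sum>i<n. l i * \<bar>s - s'\<bar>)" by (intro sum_mono g_lip s)
      also have "\<dots> \<le> L * \<bar>s - s'\<bar>"
        unfolding sum_distrib_right[symmetric] by (intro mult_right_mono sum_l') auto
      finally show ?thesis
        using dist_triangle[OF \<gamma>[OF s(1)] P[OF s(1), of n] \<gamma>[OF s(2)]]
          dist_triangle[OF P[OF s(1), of n] P[OF s(2), of n] \<gamma>[OF s(2)]]
          dist_commute[of "P s n" "\<gamma> s"] by simp
    qed
    then show "\<exists>K. \<forall>n\<ge>K. norm_dist G N (\<gamma> s) (\<gamma> s') \<le> norm_dist G N (P s n) (\<gamma> s) + L * \<bar>s - s'\<bar>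
        + norm_dist G N (P s' n) (\<gamma> s')" by blast
  qed
  have unique: "\<gamma> s = x" if "s \<in> {0..1}" "x \<in> carrier G" "(\<lambda>n. norm_dist G N (P s n) x) \<longlonglongrightarrow> 0" for s x
  proof (rule M.limitin_metric_unique[OF lim[OF that(1)] _ trivial_limit_sequentially])
    show "limitin M.mtopology (P s) x sequentially"
      using that P by (simp add: M.limitin_metric_dist_null)
  qed
  have "P 0 n = \<one>" for n unfolding P_def by (induction n) (simp_all add: g0)
  then have \<gamma>0: "\<gamma> 0 = \<one>" by (intro unique) (simp_all add: dist_self)
  have P1: "P 1 n \<otimes> W n = z" for n
  proof (induction n)
    case (Suc n)
    have closed: "P 1 n \<in> carrier G" "W n \<in> carrier G" "g n 1 \<in> carrier G"
      using P[of 1 n] W[of n] gc[of 1 n] by simp_all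
    have "P 1 (Suc n) \<otimes> W (Suc n) = (P 1 n \<otimes> g n 1) \<otimes> (inv (g n 1) \<otimes> W n)"
      by (simp add: W_Suc P_def)
    also have "\<dots> = P 1 n \<otimes> ((g n 1 \<otimes> inv (g n 1)) \<otimes> W n)"
      using closed by (simp only: m_assoc m_closed inv_closed)
    also have "\<dots> = P 1 n \<otimes> W n" using closed by simp
    finally show ?case using Suc by simp
  qed (simp add: P_def W_0 z)
  have "norm_dist G N (P 1 n) z = N (W n)" for n
    using dist_left_mult[of "P 1 n" \<one> "W n"] P[of 1 n] W[of n] P1[of n] by (simp add: dist_one_left)
  moreover have "(\<lambda>n. N (W n)) \<longlonglongrightarrow> 0"
  proof (rule LIMSEQ_imp_Suc, rule tendsto_sandwich[OF _ _ tendsto_const])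
    show "e \<longlonglongrightarrow> 0"
      unfolding e_def by (intro tendsto_mult_right_zero LIMSEQ_realpow_zero) auto
  qed (auto simp: norm_nonneg W less_imp_le[OF N_W])
  ultimately have \<gamma>1: "\<gamma> 1 = z" by (intro unique) (simp_all add: z)
  have "L < N z + \<epsilon>" using \<open>\<epsilon> > 0\<close> by (simp add: L_def c_def)
  from that[of \<gamma> L, OF \<gamma> \<gamma>0 \<gamma>1 lip this] show ?thesis .
qed

lemma (in conj_inv_normed_group) length_space_if_has_almost_geodesics:
  assumes "Metric_space.mcomplete (carrier G) (norm_dist G N)" "has_almost_geodesics G N"
  shows "length_space (carrier G) (norm_dist G N)"
  unfolding length_space_def
proof (intro conjI ballI allI impI)
  show M: "Metric_space (carrier G) (norm_dist G N)" by (rule Metric_space_norm_dist)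
  interpret M: Metric_space "carrier G" "norm_dist G N" by fact
  fix x y and \<epsilon> :: real assume xy: "x \<in> carrier G" "y \<in> carrier G" and "\<epsilon> > 0"
  then have "inv x \<otimes> y \<in> carrier G" by simp
  from exists_Lipschitz_path_from_one[OF assms this \<open>\<epsilon> > 0\<close>]
  obtain \<gamma> L where \<gamma>: "\<And>s. s \<in> {0..1} \<Longrightarrow> \<gamma> s \<in> carrier G" "\<gamma> 0 = \<one>" "\<gamma> 1 = inv x \<otimes> y"
      and lip: "\<And>s s'. s \<in> {0..1::real} \<Longrightarrow> s' \<in> {0..1} \<Longrightarrow> norm_dist G N (\<gamma> s) (\<gamma> s') \<le> L * \<bar>s - s'\<bar>"
      and L: "L < N (inv x \<otimes> y) + \<epsilon>" by blast
  have lip': "norm_dist G N (x \<otimes> \<gamma> s) (x \<otimes> \<gamma> s') \<le> L * \<bar>s - s'\<bar>" if "s \<in> {0..1}" "s' \<in> {0..1}" for s s'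
    using lip[OF that] dist_left_mult[OF xy(1) \<gamma>(1)[OF that(1)] \<gamma>(1)[OF that(2)]] by simp
  have "0 \<le> L" using order_trans[OF dist_nonneg lip[of 0 1]] by simp
  show "\<exists>\<gamma>. pathin M.mtopology \<gamma> \<and> \<gamma> 0 = x \<and> \<gamma> 1 = y \<and>
      path_length (norm_dist G N) \<gamma> < ereal (norm_dist G N x y + \<epsilon>)"
  proof (intro exI[of _ "\<lambda>s. x \<otimes> \<gamma> s"] conjI)
    show "pathin M.mtopology (\<lambda>s. x \<otimes> \<gamma> s)"
      by (rule M.pathin_if_Lipschitz[OF _ lip']) (simp_all add: xy \<gamma>)
    show "x \<otimes> \<gamma> 0 = x" "x \<otimes> \<gamma> 1 = y"
      using xy by (simp_all add: \<gamma> m_assoc[symmetric])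
    have "path_length (norm_dist G N) (\<lambda>s. x \<otimes> \<gamma> s) \<le> ereal L"
      by (rule path_length_le_Lipschitz) (fact lip', fact)
    also have "\<dots> < ereal (norm_dist G N x y + \<epsilon>)" using L xy by (simp add: dist_eq)
    finally show "path_length (norm_dist G N) (\<lambda>s. x \<otimes> \<gamma> s) < ereal (norm_dist G N x y + \<epsilon>)" .
  qed
qed

section \<open>Free products and their universal property\<close>

locale group_family =
  fixes I :: "'i set" and H :: "'i \<Rightarrow> ('b, 'c) monoid_scheme"
  assumes group_factor: "i \<in> I \<Longrightarrow> group (H i)"
begin

abbreviation words where "words \<equiv> fp_words I H"
abbreviation FP where "FP \<equiv> free_product I H"
definition word_class where "word_class w = fp_rel I H `` {w}"

lemma words_simps [simp]:
  "[] \<in> words" "(i, a) # w \<in> words \<longleftrightarrow> i \<in> I \<and> a \<in> carrier (H i) \<and> w \<in> words"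
  "u @ v \<in> words \<longleftrightarrow> u \<in> words \<and> v \<in> words"
  by (auto simp: fp_words_def)

lemma fp_rel_words: "(u, v) \<in> fp_rel I H \<Longrightarrow> u \<in> words \<and> v \<in> words"
  by (induction rule: fp_rel.induct)
    (auto simp: group_factor group.is_monoid monoid.one_closed monoid.m_closed)

lemma equiv_fp_rel: "equiv words (fp_rel I H)"
proof (rule equivI)
  show "fp_rel I H \<subseteq> words \<times> words" using fp_rel_words by auto
  show "refl_on words (fp_rel I H)" by (auto intro!: refl_onI fp_rel.refl)
  show "sym (fp_rel I H)" by (auto intro: symI fp_rel.sym)
  show "trans (fp_rel I H)" by (auto intro: transI fp_rel.trans)
qed

lemma fp_rel_context:
  "(u, v) \<in> fp_rel I H \<Longrightarrow> x \<in> words \<Longrightarrow> y \<in> words \<Longrightarrow> (x @ u @ y, x @ v @ y) \<in> fp_rel I H"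
proof (induction rule: fp_rel.induct)
  case (unit u v i)
  then show ?case using fp_rel.unit[of "x @ u" I H "v @ y" i] by simp
next
  case (merge u v i a b)
  then show ?case using fp_rel.merge[of "x @ u" I H "v @ y" i a b] by simp
qed (auto intro: fp_rel.intros)

lemma fp_rel_append:
  assumes "(u, u') \<in> fp_rel I H" "(v, v') \<in> fp_rel I H"
  shows "(u @ v, u' @ v') \<in> fp_rel I H"
  using fp_rel_context[OF assms(1), of "[]" v] fp_rel_context[OF assms(2), of u' "[]"]
    fp_rel_words[OF assms(1)] fp_rel_words[OF assms(2)] by (auto intro: fp_rel.trans)

lemma word_class_eq_iff: "u \<in> words \<Longrightarrow> v \<in> words \<Longrightarrow> word_class u = word_class v \<longleftrightarrow> (u, v) \<in> fp_rel I H"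
  unfolding word_class_def by (rule eq_equiv_class_iff[OF equiv_fp_rel])

lemma carrier_FP: "carrier FP = word_class ` words"
  by (auto simp: free_product_def quotient_def word_class_def)

lemma one_FP: "\<one>\<^bsub>FP\<^esub> = word_class []"
  by (simp add: free_product_def word_class_def)

lemma mult_FP:
  assumes "u \<in> words" "v \<in> words"
  shows "word_class u \<otimes>\<^bsub>FP\<^esub> word_class v = word_class (u @ v)"
proof -
  have "fp_rel I H `` {x @ y} = word_class (u @ v)" if "x \<in> word_class u" "y \<in> word_class v" for x y
  proof -
    have "(u @ v, x @ y) \<in> fp_rel I H"
      using that by (auto simp: word_class_def intro: fp_rel_append)
    then show ?thesis
      using fp_rel_words[of "u @ v" "x @ y"] word_class_eq_iff[of "u @ v" "x @ y"]
      by (simp add: word_class_def)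
  qed
  moreover have "u \<in> word_class u" "v \<in> word_class v"
    using assms by (auto simp: word_class_def intro: fp_rel.refl)
  ultimately show ?thesis by (auto simp: free_product_def)
qed

lemma group_FP: "group FP"
proof (rule groupI)
  show "\<exists>y\<in>carrier FP. y \<otimes>\<^bsub>FP\<^esub> x = \<one>\<^bsub>FP\<^esub>" if x: "x \<in> carrier FP" for x
  proof -
    obtain w where w: "w \<in> words" "x = word_class w" using x by (auto simp: carrier_FP)
    have "\<exists>v\<in>words. (v @ w, []) \<in> fp_rel I H"
      using w(1)
    proof (induction w)
      case Nil
      then show ?case using fp_rel.refl[of "[]" I H] by (intro bexI[of _ "[]"]) auto
    next
      case (Cons ia w)
      obtain i a where ia: "ia = (i, a)" by (cases ia)
      obtain v where v: "v \<in> words" "(v @ w, []) \<in> fp_rel I H" using Cons ia by auto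
      have i: "i \<in> I" "a \<in> carrier (H i)" "w \<in> words" using Cons.prems ia by auto
      interpret i: group "H i" by (rule group_factor[OF i(1)])
      have "(v @ [(i, inv\<^bsub>H i\<^esub> a), (i, a)] @ w, v @ [(i, inv\<^bsub>H i\<^esub> a \<otimes>\<^bsub>H i\<^esub> a)] @ w) \<in> fp_rel I H"
        using i v by (intro fp_rel.merge) auto
      moreover have "(v @ [(i, inv\<^bsub>H i\<^esub> a \<otimes>\<^bsub>H i\<^esub> a)] @ w, v @ w) \<in> fp_rel I H"
        using fp_rel.unit[OF v(1) i(3) i(1)] i by simp
      ultimately have "((v @ [(i, inv\<^bsub>H i\<^esub> a)]) @ ia # w, []) \<in> fp_rel I H"
        using v ia by (auto intro: fp_rel.trans)
      then show ?case using i v by (intro bexI[of _ "v @ [(i, inv\<^bsub>H i\<^esub> a)]"]) auto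
    qed
    then obtain v where "v \<in> words" "(v @ w, []) \<in> fp_rel I H" by blast
    then have "word_class v \<otimes>\<^bsub>FP\<^esub> x = \<one>\<^bsub>FP\<^esub>"
      using w by (simp add: mult_FP one_FP word_class_eq_iff)
    then show ?thesis using \<open>v \<in> words\<close> by (auto simp: carrier_FP)
  qed
qed (auto simp: carrier_FP one_FP mult_FP)

sublocale FP: group FP by (rule group_FP)

abbreviation incl where "incl \<equiv> fp_incl I H"

lemma incl_eq: "incl i a = word_class [(i, a)]"
  by (simp add: fp_incl_def word_class_def)

lemma incl_closed: "i \<in> I \<Longrightarrow> a \<in> carrier (H i) \<Longrightarrow> incl i a \<in> carrier FP"
  by (simp add: incl_eq carrier_FP)

lemma incl_hom:
  assumes "i \<in> I"
  shows "incl i \<in> hom (H i) FP"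
proof (rule homI)
  fix a b
  assume ab: "a \<in> carrier (H i)" "b \<in> carrier (H i)"
  interpret i: group "H i" by (rule group_factor) fact
  show "incl i (a \<otimes>\<^bsub>H i\<^esub> b) = incl i a \<otimes>\<^bsub>FP\<^esub> incl i b"
    using ab \<open>i \<in> I\<close> fp_rel.merge[of "[]" I H "[]" i a b] word_class_eq_iff[of "[(i, a), (i, b)]" "[(i, a \<otimes>\<^bsub>H i\<^esub> b)]"]
    by (simp add: incl_eq mult_FP)
qed (use assms in \<open>simp add: incl_closed\<close>)

lemma FP_induct [consumes 1, case_names one mult]:
  assumes "x \<in> carrier FP" "P \<one>\<^bsub>FP\<^esub>"
    "\<And>i a y. i \<in> I \<Longrightarrow> a \<in> carrier (H i) \<Longrightarrow> y \<in> carrier FP \<Longrightarrow> P y \<Longrightarrow> P (incl i a \<otimes>\<^bsub>FP\<^esub> y)"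
  shows "P x"
proof -
  obtain w where w: "w \<in> words" "x = word_class w" using assms(1) by (auto simp: carrier_FP)
  have "P (word_class w)" using w(1)
  proof (induction w)
    case Nil
    then show ?case using assms(2) by (simp add: one_FP)
  next
    case (Cons ia w)
    obtain i a where ia: "ia = (i, a)" by (cases ia)
    then have "P (incl i a \<otimes>\<^bsub>FP\<^esub> word_class w)"
      using Cons by (intro assms(3)) (auto simp: carrier_FP)
    then show ?case using Cons.prems ia by (simp add: incl_eq mult_FP)
  qed
  then show ?thesis using w by simp
qed

lemma FP_hom_eqI:
  assumes "group K" "f \<in> hom FP K" "g \<in> hom FP K"
    "\<And>i a. i \<in> I \<Longrightarrow> a \<in> carrier (H i) \<Longrightarrow> f (incl i a) = g (incl i a)" "x \<in> carrier FP"
  shows "f x = g x"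
proof -
  interpret f: group_hom FP K f using assms(1,2) by (simp add: group_hom_def group_hom_axioms_def group_FP)
  interpret g: group_hom FP K g using assms(1,3) by (simp add: group_hom_def group_hom_axioms_def group_FP)
  show ?thesis using assms(5) by (induction rule: FP_induct) (simp_all add: incl_closed assms(4))
qed

text \<open>Evaluating a word letter by letter in \<open>K\<close> respects the two elementary moves that generate
  \<^const>\<open>fp_rel\<close>.\<close>

lemma FP_universal:
  assumes "group K" and f: "\<And>i. i \<in> I \<Longrightarrow> f i \<in> hom (H i) K"
  obtains h where "h \<in> hom FP K" "h \<in> extensional (carrier FP)"
    "\<And>i a. i \<in> I \<Longrightarrow> a \<in> carrier (H i) \<Longrightarrow> h (incl i a) = f i a"
proof -
  interpret K: group K by fact
  have fc: "f i a \<in> carrier K" if "i \<in> I" "a \<in> carrier (H i)" for i a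
    using f[OF that(1)] that(2) by (auto simp: hom_def)
  define ev where "ev w = foldr (\<lambda>(i, a) x. f i a \<otimes>\<^bsub>K\<^esub> x) w \<one>\<^bsub>K\<^esub>" for w
  have ev_simps [simp]: "ev [] = \<one>\<^bsub>K\<^esub>" "ev ((i, a) # w) = f i a \<otimes>\<^bsub>K\<^esub> ev w" for i a w
    by (simp_all add: ev_def)
  have ev_closed [simp]: "ev w \<in> carrier K" if "w \<in> words" for w
    using that by (induction w) (auto simp: fc)
  have ev_append: "ev (u @ v) = ev u \<otimes>\<^bsub>K\<^esub> ev v" if "u \<in> words" "v \<in> words" for u v
    using that by (induction u) (auto simp: fc K.m_assoc)
  have ev_rel: "ev u = ev v" if "(u, v) \<in> fp_rel I H" for u v
    using that
  proof (induction rule: fp_rel.induct)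
    case (unit u v i)
    interpret i: group "H i" by (rule group_factor) fact
    have "f i \<one>\<^bsub>H i\<^esub> = \<one>\<^bsub>K\<^esub>" using f[OF unit(3)] hom_one i.is_group \<open>group K\<close> by blast
    then show ?case using unit by (simp add: ev_append)
  next
    case (merge u v i a b)
    interpret i: group "H i" by (rule group_factor) fact
    have "f i (a \<otimes>\<^bsub>H i\<^esub> b) = f i a \<otimes>\<^bsub>K\<^esub> f i b" using f[OF merge(3)] merge by (simp add: hom_mult)
    then show ?case using merge by (simp add: ev_append fc K.m_assoc)
  qed auto
  define h where "h = restrict (\<lambda>X. ev (SOME w. w \<in> X)) (carrier FP)"
  have h: "h (word_class w) = ev w" if "w \<in> words" for w
  proof -
    have "w \<in> word_class w" using that by (auto simp: word_class_def intro: fp_rel.refl)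
    then have "(SOME w'. w' \<in> word_class w) \<in> word_class w" by (rule someI)
    then have "(w, SOME w'. w' \<in> word_class w) \<in> fp_rel I H" by (simp add: word_class_def)
    then show ?thesis using ev_rel that by (auto simp: h_def carrier_FP)
  qed
  show ?thesis
  proof (rule that)
    show "h \<in> hom FP K"
      by (rule homI) (auto simp: carrier_FP h mult_FP ev_append)
    show "h \<in> extensional (carrier FP)" by (simp add: h_def)
    show "h (incl i a) = f i a" if "i \<in> I" "a \<in> carrier (H i)" for i a
      using that by (simp add: incl_eq h fc)
  qed
qed

end

section \<open>The groups \<open>F\<^sub>\<real>(G)\<close> and the homomorphisms \<open>\<psi>\<^sub>t\<close>\<close>

lemma real_add_group_simps [simp]:
  "carrier real_add_group = UNIV" "\<one>\<^bsub>real_add_group\<^esub> = 0" "a \<otimes>\<^bsub>real_add_group\<^esub> b = a + b"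
  by (simp_all add: real_add_group_def)

lemma group_real_add_group: "group real_add_group"
proof (rule groupI)
  show "\<exists>y\<in>carrier real_add_group. y \<otimes>\<^bsub>real_add_group\<^esub> x = \<one>\<^bsub>real_add_group\<^esub>" for x
    by (rule bexI[of _ "- x"]) simp_all
qed simp_all

interpretation real_family: group_family I "\<lambda>_. real_add_group" for I
  by (simp add: group_family_def group_real_add_group)

lemma group_FR: "group (FR G)"
  unfolding FR_def by (rule real_family.group_FP)

interpretation FR: group "FR G" for G by (rule group_FR)

context
  fixes G :: "('a, 'b) monoid_scheme" and g :: 'a
  assumes g: "g \<in> carrier G"
begin

lemma FR_bar_hom: "FR_bar G g \<in> hom real_add_group (FR G)"
  using real_family.incl_hom[OF g] by (simp add: FR_def FR_bar_def hom_def Pi_def)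

interpretation bar: group_hom real_add_group "FR G" "FR_bar G g"
  by (simp add: group_hom_def group_hom_axioms_def group_real_add_group group_FR FR_bar_hom)

lemma FR_bar_closed: "FR_bar G g r \<in> carrier (FR G)"
  using bar.hom_closed by simp

lemma FR_bar_add: "FR_bar G g (r + s) = FR_bar G g r \<otimes>\<^bsub>FR G\<^esub> FR_bar G g s"
  using bar.hom_mult[of r s] by simp

lemma FR_bar_zero: "FR_bar G g 0 = \<one>\<^bsub>FR G\<^esub>"
  using bar.hom_one by simp

lemma FR_bar_minus: "FR_bar G g (- r) = inv\<^bsub>FR G\<^esub> (FR_bar G g r)"
  using FR_bar_add[of "- r" r] by (intro FR.inv_equality[symmetric]) (simp_all add: FR_bar_zero FR_bar_closed)

lemma FR_bar_sign_pow:
  "e \<in> {1, - 1} \<Longrightarrow> FR_bar G g r [^]\<^bsub>FR G\<^esub> (e :: int) = FR_bar G g (of_int e * r)"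
  by (auto simp: FR_bar_closed FR_bar_minus FR.int_pow_neg FR.int_pow_1)

end

lemma FR_induct [consumes 1, case_names one mult]:
  assumes "x \<in> carrier (FR G)" "P \<one>\<^bsub>FR G\<^esub>"
    "\<And>g r y. g \<in> carrier G \<Longrightarrow> y \<in> carrier (FR G) \<Longrightarrow> P y \<Longrightarrow> P (FR_bar G g r \<otimes>\<^bsub>FR G\<^esub> y)"
  shows "P x"
  using assms unfolding FR_def FR_bar_def
  by (induction rule: real_family.FP_induct) auto

lemma FR_hom_unique:
  assumes "group K" "f \<in> hom (FR G) K" "h \<in> hom (FR G) K"
    "\<And>g r. g \<in> carrier G \<Longrightarrow> f (FR_bar G g r) = h (FR_bar G g r)" "x \<in> carrier (FR G)"
  shows "f x = h x"
  using real_family.FP_hom_eqI[of K f "carrier G" h x] assms unfolding FR_def FR_bar_def by simp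

lemma FR_universal:
  assumes "group K" "\<And>g. g \<in> carrier G \<Longrightarrow> f g \<in> hom real_add_group K"
  obtains h where "h \<in> hom (FR G) K" "h \<in> extensional (carrier (FR G))"
    "\<And>g r. g \<in> carrier G \<Longrightarrow> h (FR_bar G g r) = f g r"
  using real_family.FP_universal[of K "carrier G" f] assms unfolding FR_def FR_bar_def
  by simp blast

lemma FR_psi_exists:
  "FR_psi G t \<in> hom (FR G) (FR G) \<and> (\<forall>g\<in>carrier G. \<forall>r. FR_psi G t (FR_bar G g r) = FR_bar G g (t * r))"
proof -
  define Q where "Q f \<longleftrightarrow> f \<in> extensional (carrier (FR G)) \<and> f \<in> hom (FR G) (FR G) \<and>
             (\<forall>g\<in>carrier G. \<forall>r. f (FR_bar G g r) = FR_bar G g (t * r))" for f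
  have "(\<lambda>r. FR_bar G g (t * r)) \<in> hom real_add_group (FR G)" if "g \<in> carrier G" for g
    using that by (intro homI) (simp_all add: FR_bar_closed FR_bar_add distrib_left)
  then obtain f where f: "f \<in> hom (FR G) (FR G)" "f \<in> extensional (carrier (FR G))"
      "\<And>g r. g \<in> carrier G \<Longrightarrow> f (FR_bar G g r) = FR_bar G g (t * r)"
    using FR_universal[OF group_FR, of G "\<lambda>g r. FR_bar G g (t * r)" G] by metis
  have "Q f" using f by (simp add: Q_def)
  moreover have "f' = f" if "Q f'" for f'
  proof (rule extensionalityI)
    show "f' x = f x" if "x \<in> carrier (FR G)" for x
      by (rule FR_hom_unique[OF group_FR _ _ _ that]) (use \<open>Q f\<close> \<open>Q f'\<close> in \<open>auto simp: Q_def\<close>)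
  qed (use \<open>Q f\<close> \<open>Q f'\<close> in \<open>auto simp: Q_def\<close>)
  ultimately have "Q (THE f. Q f)" by (rule theI)
  moreover have "FR_psi G t = (THE f. Q f)" unfolding FR_psi_def Q_def ..
  ultimately show ?thesis by (simp add: Q_def)
qed

lemma FR_psi_hom: "FR_psi G t \<in> hom (FR G) (FR G)"
  and FR_psi_bar: "g \<in> carrier G \<Longrightarrow> FR_psi G t (FR_bar G g r) = FR_bar G g (t * r)"
  using FR_psi_exists[of G t] by auto

interpretation FR_psi: group_hom "FR G" "FR G" "FR_psi G t" for G t
  by (simp add: group_hom_def group_hom_axioms_def group_FR FR_psi_hom)

section \<open>The groups \<open>F(G)\<close> and the homomorphism \<open>\<pi>\<close>\<close>

definition FZ_generators :: "('a, 'b) monoid_scheme \<Rightarrow> ('a \<times> real) list set set" where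
  "FZ_generators G = {FR_bar G g 1 | g. g \<in> carrier G}"

lemma group_FZ: "group (FZ G)"
  unfolding FZ_def by (rule FR.group_subgroup_generated)

lemma carrier_FZ: "carrier (FZ G) = generate (FR G) (FZ_generators G)"
proof -
  have "carrier (FR G) \<inter> FZ_generators G = FZ_generators G"
    by (auto simp: FZ_generators_def FR_bar_closed)
  then show ?thesis by (simp add: FZ_def carrier_subgroup_generated FZ_generators_def)
qed

lemma FZ_subset: "x \<in> carrier (FZ G) \<Longrightarrow> x \<in> carrier (FR G)"
  unfolding FZ_def using FR.carrier_subgroup_generated_subset by blast

lemma FZ_simps [simp]: "x \<otimes>\<^bsub>FZ G\<^esub> y = x \<otimes>\<^bsub>FR G\<^esub> y" "\<one>\<^bsub>FZ G\<^esub> = \<one>\<^bsub>FR G\<^esub>"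
  by (simp_all add: FZ_def)

lemma inv_FZ: "x \<in> carrier (FZ G) \<Longrightarrow> inv\<^bsub>FZ G\<^esub> x = inv\<^bsub>FR G\<^esub> x"
  unfolding FZ_def by (rule FR.inv_subgroup_generated)

interpretation FZ: group "FZ G" for G by (rule group_FZ)

lemma FZ_bar_one: "g \<in> carrier G \<Longrightarrow> FR_bar G g 1 \<in> carrier (FZ G)"
  by (auto simp: carrier_FZ FZ_generators_def intro: generate.incl)

lemma FZ_bar_int:
  assumes "g \<in> carrier G"
  shows "FR_bar G g (of_int n) \<in> carrier (FZ G)"
proof -
  have nat: "FR_bar G g (real n) \<in> carrier (FZ G)" for n
  proof (induction n)
    case 0
    then show ?case using assms FZ.one_closed[of G] by (simp add: FR_bar_zero)
  next
    case (Suc n)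
    then show ?case
      using assms FZ.m_closed[OF FZ_bar_one[OF assms] Suc] by (simp add: FR_bar_add)
  qed
  show ?thesis
  proof (cases n)
    case (nonneg m)
    then show ?thesis using nat[of m] by simp
  next
    case (neg m)
    have "FR_bar G g (of_int n) = inv\<^bsub>FZ G\<^esub> (FR_bar G g (real (Suc m)))"
      using neg nat[of "Suc m"] FR_bar_minus[OF assms, of "real (Suc m)"] by (simp add: inv_FZ)
    then show ?thesis using FZ.inv_closed[OF nat[of "Suc m"]] by simp
  qed
qed

lemma FZ_induct [consumes 1, case_names one gen inv mult]:
  assumes "x \<in> carrier (FZ G)" "P \<one>\<^bsub>FR G\<^esub>"
    "\<And>g. g \<in> carrier G \<Longrightarrow> P (FR_bar G g 1)"
    "\<And>g. g \<in> carrier G \<Longrightarrow> P (FR_bar G g (- 1))"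
    "\<And>x y. x \<in> carrier (FZ G) \<Longrightarrow> P x \<Longrightarrow> y \<in> carrier (FZ G) \<Longrightarrow> P y \<Longrightarrow> P (x \<otimes>\<^bsub>FR G\<^esub> y)"
  shows "P x"
  using assms(1) unfolding carrier_FZ
proof (induction rule: generate.induct)
  case (inv h)
  then show ?case using assms(4) by (auto simp: FZ_generators_def FR_bar_minus[symmetric])
qed (use assms in \<open>auto simp: FZ_generators_def carrier_FZ\<close>)

context group
begin

text \<open>The cyclic group generated by \<open>g\<close> acts on \<open>G\<close> by left multiplication. The suspension flow of this
  action extends it to a real parameter at the price of replacing \<open>G\<close> by \<open>G \<times> [0,1)\<close>: the second coordinate
  moves at unit speed, and whenever it wraps around, the first one is multiplied by \<open>g\<close>. The space
  does not depend on \<open>g\<close>, so the flows of all \<open>g\<close> together form an action of \<open>F\<^sub>\<real>(G)\<close>.\<close>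

definition suspension where "suspension = carrier G \<times> {0..<1::real}"

definition flow where
  "flow g r = restrict (\<lambda>(a, \<theta>). (g [^] \<lfloor>\<theta> + r\<rfloor> \<otimes> a, frac (\<theta> + r))) suspension"

lemma flow_eq:
  "a \<in> carrier G \<Longrightarrow> 0 \<le> \<theta> \<Longrightarrow> \<theta> < 1 \<Longrightarrow> flow g r (a, \<theta>) = (g [^] \<lfloor>\<theta> + r\<rfloor> \<otimes> a, frac (\<theta> + r))"
  by (simp add: flow_def suspension_def)

lemma flow_closed: "g \<in> carrier G \<Longrightarrow> p \<in> suspension \<Longrightarrow> flow g r p \<in> suspension"
  by (auto simp: flow_def suspension_def frac_lt_1)

lemma flow_add:
  assumes "g \<in> carrier G" "p \<in> suspension"
  shows "flow g r (flow g s p) = flow g (r + s) p"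
proof -
  obtain a \<theta> where p: "p = (a, \<theta>)" "a \<in> carrier G" "0 \<le> \<theta>" "\<theta> < 1"
    using assms(2) by (auto simp: suspension_def)
  have "frac (\<theta> + s) + r = \<theta> + (r + s) - of_int \<lfloor>\<theta> + s\<rfloor>" by (simp add: frac_def)
  then have fl: "\<lfloor>frac (\<theta> + s) + r\<rfloor> = \<lfloor>\<theta> + (r + s)\<rfloor> - \<lfloor>\<theta> + s\<rfloor>"
    and fr: "frac (frac (\<theta> + s) + r) = frac (\<theta> + (r + s))"
    by (simp_all only: floor_diff_of_int frac_def)
  have "g [^] \<lfloor>frac (\<theta> + s) + r\<rfloor> \<otimes> (g [^] \<lfloor>\<theta> + s\<rfloor> \<otimes> a) = g [^] \<lfloor>\<theta> + (r + s)\<rfloor> \<otimes> a"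
    unfolding fl using assms p by (simp add: m_assoc[symmetric] int_pow_mult[symmetric])
  then show ?thesis
    using assms p by (simp add: flow_eq fr frac_lt_1 add_ac)
qed

lemma flow_zero:
  assumes "p \<in> suspension"
  shows "flow g 0 p = p"
proof -
  obtain a \<theta> where p: "p = (a, \<theta>)" "a \<in> carrier G" "0 \<le> \<theta>" "\<theta> < 1"
    using assms by (auto simp: suspension_def)
  then have "\<lfloor>\<theta>\<rfloor> = 0" by linarith
  then show ?thesis using p by (simp add: flow_eq frac_def)
qed

lemma flow_hom:
  assumes "g \<in> carrier G"
  shows "flow g \<in> hom real_add_group (BijGroup suspension)"
proof (rule homI)
  have Bij: "flow g r \<in> Bij suspension" for r
  proof -
    have "bij_betw (flow g r) suspension suspension"
      by (rule bij_betwI[where g = "flow g (- r)"])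
        (auto simp: flow_closed flow_add flow_zero assms)
    then show ?thesis by (simp add: Bij_def flow_def)
  qed
  then show "flow g r \<in> carrier (BijGroup suspension)" for r by (simp add: BijGroup_def)
  show "flow g (r \<otimes>\<^bsub>real_add_group\<^esub> s) = flow g r \<otimes>\<^bsub>BijGroup suspension\<^esub> flow g s" for r s
  proof (rule extensionalityI[where A = suspension])
    have mult: "flow g r \<otimes>\<^bsub>BijGroup suspension\<^esub> flow g s = compose suspension (flow g r) (flow g s)"
      using Bij by (simp add: BijGroup_def)
    show "flow g (r \<otimes>\<^bsub>real_add_group\<^esub> s) \<in> extensional suspension"
      by (simp add: flow_def)
    show "flow g r \<otimes>\<^bsub>BijGroup suspension\<^esub> flow g s \<in> extensional suspension"
      unfolding mult by (rule compose_extensional)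
    show "flow g (r \<otimes>\<^bsub>real_add_group\<^esub> s) p = (flow g r \<otimes>\<^bsub>BijGroup suspension\<^esub> flow g s) p"
      if "p \<in> suspension" for p
      unfolding mult using that by (simp add: compose_eq flow_add assms)
  qed
qed

text \<open>At time \<open>1\<close> the flow of \<open>g\<close> maps \<open>(a, 0)\<close> to \<open>(g a, 0)\<close>. Hence each \<open>x\<close> in \<open>F(G)\<close> acts
  on \<open>G \<times> {0}\<close> as left multiplication by some element of \<open>G\<close>, which can be recovered as the first coordinate of
  \<open>x \<cdot> (1, 0)\<close> and is multiplicative in \<open>x\<close>.\<close>

lemma FZ_pi_exists:
  "FZ_pi G \<in> hom (FZ G) G \<and> (\<forall>g\<in>carrier G. FZ_pi G (FR_bar G g 1) = g)"
proof -
  define Q where "Q f \<longleftrightarrow> f \<in> extensional (carrier (FZ G)) \<and> f \<in> hom (FZ G) G \<and>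
             (\<forall>g\<in>carrier G. f (FR_bar G g 1) = g)" for f
  obtain h where h: "h \<in> hom (FR G) (BijGroup suspension)"
      "\<And>g r. g \<in> carrier G \<Longrightarrow> h (FR_bar G g r) = flow g r"
    by (rule FR_universal[of "BijGroup suspension" G flow]) (auto intro: group_BijGroup flow_hom)
  have base: "(a, 0) \<in> suspension" if "a \<in> carrier G" for a using that by (simp add: suspension_def)
  interpret h: group_hom "FR G" "BijGroup suspension" h
    using h(1) by (simp add: group_hom_def group_hom_axioms_def group_FR group_BijGroup)
  have h_mult: "(h x \<otimes>\<^bsub>BijGroup suspension\<^esub> h y) p = h x (h y p)"
    if "x \<in> carrier (FR G)" "y \<in> carrier (FR G)" "p \<in> suspension" for x y p
    using h.hom_closed[OF that(1)] h.hom_closed[OF that(2)] that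
    by (simp add: BijGroup_def compose_def)
  have act: "\<exists>b\<in>carrier G. \<forall>a\<in>carrier G. h x (a, 0) = (b \<otimes> a, 0)" if "x \<in> carrier (FZ G)" for x
    using that
  proof (induction rule: FZ_induct)
    case one
    then show ?case using base h.hom_one by (intro bexI[of _ \<one>]) (simp_all add: BijGroup_def)
  next
    case (gen g)
    then show ?case by (intro bexI[of _ g]) (simp_all add: h flow_eq int_pow_1)
  next
    case (inv g)
    have "\<lfloor>- 1 :: real\<rfloor> = - 1" by linarith
    then have "flow g (- 1) (a, 0) = (inv g \<otimes> a, 0)" if "a \<in> carrier G" for a
      using inv that int_pow_neg[of g 1] by (simp add: flow_eq frac_def)
    then show ?case using inv by (intro bexI[of _ "inv g"]) (simp_all add: h)
  next
    case (mult x y)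
    then obtain b c where bc: "b \<in> carrier G" "\<forall>a\<in>carrier G. h x (a, 0) = (b \<otimes> a, 0)"
        "c \<in> carrier G" "\<forall>a\<in>carrier G. h y (a, 0) = (c \<otimes> a, 0)" by auto
    then show ?case using mult base
      by (intro bexI[of _ "b \<otimes> c"]) (auto simp: h_mult FZ_subset m_assoc)
  qed
  define f where "f = restrict (\<lambda>x. fst (h x (\<one>, 0))) (carrier (FZ G))"
  have f: "f x \<in> carrier G \<and> h x (a, 0) = (f x \<otimes> a, 0)" if x: "x \<in> carrier (FZ G)" and "a \<in> carrier G" for x a
  proof -
    obtain b where b: "b \<in> carrier G" "\<And>a. a \<in> carrier G \<Longrightarrow> h x (a, 0) = (b \<otimes> a, 0)"
      using act[OF x] by auto
    then show ?thesis using that by (simp add: f_def)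
  qed
  have "Q f"
    unfolding Q_def
  proof (intro conjI ballI)
    show "f \<in> extensional (carrier (FZ G))" by (simp add: f_def)
    show "f \<in> hom (FZ G) G"
    proof (rule homI)
      show "f x \<in> carrier G" if "x \<in> carrier (FZ G)" for x using f[OF that one_closed] by simp
      fix x y assume xy: "x \<in> carrier (FZ G)" "y \<in> carrier (FZ G)"
      have "h (x \<otimes>\<^bsub>FR G\<^esub> y) (\<one>, 0) = (f x \<otimes> f y, 0)"
        using f[OF xy(1)] f[OF xy(2) one_closed] xy base[of \<one>] by (simp add: h_mult FZ_subset)
      then show "f (x \<otimes>\<^bsub>FZ G\<^esub> y) = f x \<otimes> f y"
        using FZ.m_closed[OF xy] by (simp add: f_def)
    qed
    show "f (FR_bar G g 1) = g" if "g \<in> carrier G" for g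
      using that by (simp add: f_def FZ_bar_one h flow_eq int_pow_1)
  qed
  moreover have "f' = f" if "Q f'" for f'
  proof (rule extensionalityI)
    interpret f: group_hom "FZ G" G f using \<open>Q f\<close> by unfold_locales (simp add: Q_def)
    interpret f': group_hom "FZ G" G f' using \<open>Q f'\<close> by unfold_locales (simp add: Q_def)
    show "f' x = f x" if "x \<in> carrier (FZ G)" for x
      using that
    proof (induction rule: FZ_induct)
      case (inv g)
      have "FR_bar G g (- 1) = inv\<^bsub>FZ G\<^esub> (FR_bar G g 1)"
        using inv by (simp add: FR_bar_minus inv_FZ FZ_bar_one)
      then show ?case using inv \<open>Q f\<close> \<open>Q f'\<close> FZ_bar_one[OF inv] by (simp add: Q_def)
    next
      case (mult x y)
      then show ?case using f.hom_mult[of x y] f'.hom_mult[of x y] by simp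
    qed (use f.hom_one f'.hom_one \<open>Q f\<close> \<open>Q f'\<close> in \<open>auto simp: Q_def\<close>)
  qed (use \<open>Q f\<close> \<open>Q f'\<close> in \<open>auto simp: Q_def\<close>)
  ultimately have "Q (THE f. Q f)" by (rule theI)
  moreover have "FZ_pi G = (THE f. Q f)" unfolding FZ_pi_def Q_def ..
  ultimately show ?thesis by (simp add: Q_def)
qed

end

section \<open>The pseudonorm on \<open>F\<^sub>\<real>(G)\<close>\<close>

context conj_inv_normed_group
begin

abbreviation factor_lists :: "(('a \<times> real) list set \<times> 'a \<times> real \<times> int) list set" where
  "factor_lists \<equiv> lists (carrier (FR G) \<times> carrier G \<times> UNIV \<times> {1, - 1})"

definition cost :: "(('a \<times> real) list set \<times> 'a \<times> real \<times> int) list \<Rightarrow> real" where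
  "cost fs = (\<Sum>(h, g, r, e)\<leftarrow>fs. \<bar>r\<bar> * N g)"

lemma cost_simps [simp]:
  "cost [] = 0" "cost ((h, g, r, e) # fs) = \<bar>r\<bar> * N g + cost fs" "cost (fs @ fs') = cost fs + cost fs'"
  by (simp_all add: cost_def)

definition conj_factor where
  "conj_factor h g r e = h \<otimes>\<^bsub>FR G\<^esub> FR_bar G g (of_int e * r) \<otimes>\<^bsub>FR G\<^esub> inv\<^bsub>FR G\<^esub> h"

lemma FR_conj_prod_Nil [simp]: "FR_conj_prod G [] = \<one>\<^bsub>FR G\<^esub>"
  by (simp add: FR_conj_prod_def)

lemma FR_conj_prod_Cons [simp]:
  "g \<in> carrier G \<Longrightarrow> e \<in> {1, - 1} \<Longrightarrow>
    FR_conj_prod G ((h, g, r, e) # fs) = conj_factor h g r e \<otimes>\<^bsub>FR G\<^esub> FR_conj_prod G fs"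
  unfolding FR_conj_prod_def conj_factor_def by (simp only: list.map foldr.simps comp_def prod.case FR_bar_sign_pow)

lemma conj_factor_closed:
  "h \<in> carrier (FR G) \<Longrightarrow> g \<in> carrier G \<Longrightarrow> conj_factor h g r e \<in> carrier (FR G)"
  by (simp add: conj_factor_def FR_bar_closed)

text \<open>The exponents \<open>1\<close> and \<open>- 1\<close> are kept together as a membership, since most proofs treat them alike.\<close>

lemma factor_lists_induct [consumes 1, case_names Nil Cons]:
  assumes "fs \<in> factor_lists" "P []"
    "\<And>h g r e fs. h \<in> carrier (FR G) \<Longrightarrow> g \<in> carrier G \<Longrightarrow> e \<in> {1, - 1} \<Longrightarrow> fs \<in> factor_lists
      \<Longrightarrow> P fs \<Longrightarrow> P ((h, g, r, e) # fs)"
  shows "P fs"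
  using assms(1)
proof (induction fs)
  case (Cons f fs)
  obtain h g r e where f: "f = (h, g, r, e)" by (cases f)
  show ?case unfolding f by (rule assms(3)) (use Cons f in auto)
qed (rule assms(2))

lemma FR_conj_prod_closed: "fs \<in> factor_lists \<Longrightarrow> FR_conj_prod G fs \<in> carrier (FR G)"
proof (induction rule: factor_lists_induct)
  case (Cons h g r e fs)
  then show ?case
    by (simp only: FR_conj_prod_Cons FR.m_closed conj_factor_closed)
qed simp

lemma FR_conj_prod_append:
  assumes "fs \<in> factor_lists" "fs' \<in> factor_lists"
  shows "FR_conj_prod G (fs @ fs') = FR_conj_prod G fs \<otimes>\<^bsub>FR G\<^esub> FR_conj_prod G fs'"
  using assms(1)
proof (induction rule: factor_lists_induct)
  case (Cons h g r e fs)
  then show ?case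
    using FR.m_assoc[OF conj_factor_closed[OF Cons(1,2)] FR_conj_prod_closed[OF Cons(4)]
        FR_conj_prod_closed[OF assms(2)]]
    by (simp only: append_Cons FR_conj_prod_Cons)
qed (simp add: FR_conj_prod_closed assms(2))

lemma inv_conj_factor:
  assumes "h \<in> carrier (FR G)" "g \<in> carrier G"
  shows "inv\<^bsub>FR G\<^esub> (conj_factor h g r e) = conj_factor h g (- r) e"
  using assms FR_bar_closed[OF assms(2)] FR_bar_minus[OF assms(2), of "of_int e * r"]
  by (simp add: conj_factor_def FR.inv_mult_group FR.m_assoc)

lemma conj_conj_factor:
  assumes "h \<in> carrier (FR G)" "k \<in> carrier (FR G)" "g \<in> carrier G"
  shows "k \<otimes>\<^bsub>FR G\<^esub> conj_factor h g r e \<otimes>\<^bsub>FR G\<^esub> inv\<^bsub>FR G\<^esub> k = conj_factor (k \<otimes>\<^bsub>FR G\<^esub> h) g r e"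
  using assms FR_bar_closed[OF assms(3)]
  by (simp add: conj_factor_def FR.inv_mult_group FR.m_assoc)

lemma FR_inverse_factors:
  "fs \<in> factor_lists \<Longrightarrow> \<exists>fs'\<in>factor_lists. FR_conj_prod G fs' = inv\<^bsub>FR G\<^esub> (FR_conj_prod G fs) \<and> cost fs' = cost fs"
proof (induction rule: factor_lists_induct)
  case Nil
  then show ?case by (intro bexI[of _ "[]"]) auto
next
  case (Cons h g r e fs)
  then obtain fs' where fs': "fs' \<in> factor_lists"
      "FR_conj_prod G fs' = inv\<^bsub>FR G\<^esub> (FR_conj_prod G fs)" "cost fs' = cost fs" by blast
  have single: "[(h, g, - r, e)] \<in> factor_lists" using Cons by simp
  have "FR_conj_prod G (fs' @ [(h, g, - r, e)]) = inv\<^bsub>FR G\<^esub> (FR_conj_prod G ((h, g, r, e) # fs))"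
    unfolding FR_conj_prod_append[OF fs'(1) single] FR_conj_prod_Cons[OF Cons(2,3)] FR_conj_prod_Nil
    using Cons(1,2,4) fs'(2)
    by (simp add: FR.inv_mult_group conj_factor_closed FR_conj_prod_closed inv_conj_factor)
  moreover have "fs' @ [(h, g, - r, e)] \<in> factor_lists"
    using single fs'(1) by (simp only: append_in_lists_conv)
  moreover have "cost (fs' @ [(h, g, - r, e)]) = cost ((h, g, r, e) # fs)"
    using fs'(3) by simp
  ultimately show ?case by blast
qed

lemma FR_conj_factors:
  assumes "k \<in> carrier (FR G)"
  shows "fs \<in> factor_lists \<Longrightarrow>
    \<exists>fs'\<in>factor_lists. FR_conj_prod G fs' = k \<otimes>\<^bsub>FR G\<^esub> FR_conj_prod G fs \<otimes>\<^bsub>FR G\<^esub> inv\<^bsub>FR G\<^esub> k \<and> cost fs' = cost fs"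
proof (induction rule: factor_lists_induct)
  case Nil
  then show ?case using assms by (intro bexI[of _ "[]"]) auto
next
  case (Cons h g r e fs)
  then obtain fs' where fs': "fs' \<in> factor_lists"
      "FR_conj_prod G fs' = k \<otimes>\<^bsub>FR G\<^esub> FR_conj_prod G fs \<otimes>\<^bsub>FR G\<^esub> inv\<^bsub>FR G\<^esub> k" "cost fs' = cost fs" by blast
  let ?a = "conj_factor h g r e" and ?b = "FR_conj_prod G fs"
  have closed: "?a \<in> carrier (FR G)" "?b \<in> carrier (FR G)"
    using Cons by (simp_all only: conj_factor_closed FR_conj_prod_closed)
  have "FR_conj_prod G ((k \<otimes>\<^bsub>FR G\<^esub> h, g, r, e) # fs')
      = (k \<otimes>\<^bsub>FR G\<^esub> ?a \<otimes>\<^bsub>FR G\<^esub> inv\<^bsub>FR G\<^esub> k) \<otimes>\<^bsub>FR G\<^esub> (k \<otimes>\<^bsub>FR G\<^esub> ?b \<otimes>\<^bsub>FR G\<^esub> inv\<^bsub>FR G\<^esub> k)"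
    unfolding FR_conj_prod_Cons[OF Cons(2,3)] fs'(2) conj_conj_factor[OF Cons(1) assms Cons(2)] ..
  also have "\<dots> = k \<otimes>\<^bsub>FR G\<^esub> (?a \<otimes>\<^bsub>FR G\<^esub> ((inv\<^bsub>FR G\<^esub> k \<otimes>\<^bsub>FR G\<^esub> k) \<otimes>\<^bsub>FR G\<^esub> ?b)) \<otimes>\<^bsub>FR G\<^esub> inv\<^bsub>FR G\<^esub> k"
    using closed assms by (simp only: FR.m_assoc FR.m_closed FR.inv_closed)
  also have "\<dots> = k \<otimes>\<^bsub>FR G\<^esub> FR_conj_prod G ((h, g, r, e) # fs) \<otimes>\<^bsub>FR G\<^esub> inv\<^bsub>FR G\<^esub> k"
    unfolding FR_conj_prod_Cons[OF Cons(2,3)] using closed assms by simp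
  finally show ?case using Cons(1-3) assms fs' by (intro bexI[of _ "(k \<otimes>\<^bsub>FR G\<^esub> h, g, r, e) # fs'"]) auto
qed

lemma FR_factors_exist: "x \<in> carrier (FR G) \<Longrightarrow> \<exists>fs\<in>factor_lists. x = FR_conj_prod G fs"
proof (induction rule: FR_induct)
  case one
  then show ?case by (intro bexI[of _ "[]"]) auto
next
  case (mult g r y)
  then obtain fs where "fs \<in> factor_lists" "y = FR_conj_prod G fs" by blast
  then show ?case using mult(1)
    by (intro bexI[of _ "(\<one>\<^bsub>FR G\<^esub>, g, r, 1) # fs"]) (auto simp: conj_factor_def FR_bar_closed)
qed

lemma cost_nonneg: "fs \<in> factor_lists \<Longrightarrow> 0 \<le> cost fs"
  by (induction rule: factor_lists_induct) (auto simp: norm_nonneg)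

lemma FR_norm_eq: "FR_norm G N x = Inf {cost fs | fs. fs \<in> factor_lists \<and> x = FR_conj_prod G fs}"
  by (simp add: FR_norm_def cost_def)

lemma FR_norm_le_cost: "fs \<in> factor_lists \<Longrightarrow> FR_norm G N (FR_conj_prod G fs) \<le> cost fs"
  unfolding FR_norm_eq by (rule cInf_lower) (auto intro!: bdd_belowI[of _ 0] cost_nonneg)

text \<open>Together with the preceding upper bound this determines the pseudonorm; all its
  properties follow from operations on lists of factors that preserve or add costs.\<close>

lemma FR_norm_less_obtains:
  assumes "x \<in> carrier (FR G)" "FR_norm G N x < c"
  obtains fs where "fs \<in> factor_lists" "x = FR_conj_prod G fs" "cost fs < c"
proof -
  have "{cost fs | fs. fs \<in> factor_lists \<and> x = FR_conj_prod G fs} \<noteq> {}"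
    using FR_factors_exist[OF assms(1)] by blast
  from cInf_lessD[OF this assms(2)[unfolded FR_norm_eq]] that show ?thesis by blast
qed

lemma FR_norm_pseudonormed: "conj_inv_pseudonormed_group (FR G) (FR_norm G N)"
proof -
  have nonneg: "0 \<le> FR_norm G N x" if x: "x \<in> carrier (FR G)" for x
  proof (rule ccontr)
    assume "\<not> 0 \<le> FR_norm G N x"
    then have "FR_norm G N x < 0" by simp
    then obtain fs where "fs \<in> factor_lists" "cost fs < 0"
      by (rule FR_norm_less_obtains[OF x])
    then show False using cost_nonneg[of fs] by simp
  qed
  have inv_le: "FR_norm G N (inv\<^bsub>FR G\<^esub> x) \<le> FR_norm G N x" if x: "x \<in> carrier (FR G)" for x
  proof (rule dense_ge)
    fix c assume "FR_norm G N x < c"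
    then obtain fs where fs: "fs \<in> factor_lists" "x = FR_conj_prod G fs" "cost fs < c"
      by (rule FR_norm_less_obtains[OF x])
    obtain fs' where "fs' \<in> factor_lists" "FR_conj_prod G fs' = inv\<^bsub>FR G\<^esub> x" "cost fs' = cost fs"
      using FR_inverse_factors[OF fs(1)] fs(2) by blast
    then show "FR_norm G N (inv\<^bsub>FR G\<^esub> x) \<le> c" using FR_norm_le_cost[of fs'] fs(3) by simp
  qed
  have conj_le: "FR_norm G N (k \<otimes>\<^bsub>FR G\<^esub> x \<otimes>\<^bsub>FR G\<^esub> inv\<^bsub>FR G\<^esub> k) \<le> FR_norm G N x"
    if x: "x \<in> carrier (FR G)" and k: "k \<in> carrier (FR G)" for x k
  proof (rule dense_ge)
    fix c assume "FR_norm G N x < c"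
    then obtain fs where fs: "fs \<in> factor_lists" "x = FR_conj_prod G fs" "cost fs < c"
      by (rule FR_norm_less_obtains[OF x])
    obtain fs' where "fs' \<in> factor_lists" "FR_conj_prod G fs' = k \<otimes>\<^bsub>FR G\<^esub> x \<otimes>\<^bsub>FR G\<^esub> inv\<^bsub>FR G\<^esub> k" "cost fs' = cost fs"
      using FR_conj_factors[OF k fs(1)] fs(2) by blast
    then show "FR_norm G N (k \<otimes>\<^bsub>FR G\<^esub> x \<otimes>\<^bsub>FR G\<^esub> inv\<^bsub>FR G\<^esub> k) \<le> c"
      using FR_norm_le_cost[of fs'] fs(3) by simp
  qed
  show ?thesis
  proof unfold_locales
    show "FR_norm G N \<one>\<^bsub>FR G\<^esub> = 0"
      using FR_norm_le_cost[of "[]"] nonneg[OF FR.one_closed] by simp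
  next
    fix x assume "x \<in> carrier (FR G)"
    then show "FR_norm G N (inv\<^bsub>FR G\<^esub> x) = FR_norm G N x"
      using inv_le[of x] inv_le[of "inv\<^bsub>FR G\<^esub> x"] by simp
  next
    fix x y assume xy: "x \<in> carrier (FR G)" "y \<in> carrier (FR G)"
    show "FR_norm G N (x \<otimes>\<^bsub>FR G\<^esub> y) \<le> FR_norm G N x + FR_norm G N y"
    proof (rule field_le_epsilon)
      fix e :: real assume "e > 0"
      obtain fs where fs: "fs \<in> factor_lists" "x = FR_conj_prod G fs" "cost fs < FR_norm G N x + e/2"
        by (rule FR_norm_less_obtains[OF xy(1), of "FR_norm G N x + e/2"]) (use \<open>e > 0\<close> in auto)
      obtain fs' where fs': "fs' \<in> factor_lists" "y = FR_conj_prod G fs'" "cost fs' < FR_norm G N y + e/2"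
        by (rule FR_norm_less_obtains[OF xy(2), of "FR_norm G N y + e/2"]) (use \<open>e > 0\<close> in auto)
      have "FR_norm G N (x \<otimes>\<^bsub>FR G\<^esub> y) \<le> cost (fs @ fs')"
        using FR_norm_le_cost[of "fs @ fs'"] FR_conj_prod_append[OF fs(1) fs'(1)] fs fs' by simp
      then show "FR_norm G N (x \<otimes>\<^bsub>FR G\<^esub> y) \<le> FR_norm G N x + FR_norm G N y + e"
        using fs(3) fs'(3) by simp
    qed
  next
    fix x k assume xk: "x \<in> carrier (FR G)" "k \<in> carrier (FR G)"
    have "inv\<^bsub>FR G\<^esub> k \<otimes>\<^bsub>FR G\<^esub> (k \<otimes>\<^bsub>FR G\<^esub> x \<otimes>\<^bsub>FR G\<^esub> inv\<^bsub>FR G\<^esub> k) \<otimes>\<^bsub>FR G\<^esub> inv\<^bsub>FR G\<^esub> (inv\<^bsub>FR G\<^esub> k)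
        = (inv\<^bsub>FR G\<^esub> k \<otimes>\<^bsub>FR G\<^esub> k) \<otimes>\<^bsub>FR G\<^esub> x \<otimes>\<^bsub>FR G\<^esub> (inv\<^bsub>FR G\<^esub> k \<otimes>\<^bsub>FR G\<^esub> k)"
      using xk by (simp only: FR.m_assoc FR.m_closed FR.inv_closed FR.inv_inv)
    then have "inv\<^bsub>FR G\<^esub> k \<otimes>\<^bsub>FR G\<^esub> (k \<otimes>\<^bsub>FR G\<^esub> x \<otimes>\<^bsub>FR G\<^esub> inv\<^bsub>FR G\<^esub> k) \<otimes>\<^bsub>FR G\<^esub> inv\<^bsub>FR G\<^esub> (inv\<^bsub>FR G\<^esub> k) = x"
      using xk by (simp only: FR.l_inv FR.l_one FR.r_one)
    then show "FR_norm G N (k \<otimes>\<^bsub>FR G\<^esub> x \<otimes>\<^bsub>FR G\<^esub> inv\<^bsub>FR G\<^esub> k) = FR_norm G N x"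
      using conj_le[OF xk] conj_le[of "k \<otimes>\<^bsub>FR G\<^esub> x \<otimes>\<^bsub>FR G\<^esub> inv\<^bsub>FR G\<^esub> k" "inv\<^bsub>FR G\<^esub> k"] xk by simp
  qed (fact nonneg)
qed

end

sublocale conj_inv_normed_group \<subseteq> FRN: conj_inv_pseudonormed_group "FR G" "FR_norm G N"
  by (rule FR_norm_pseudonormed)

context conj_inv_normed_group
begin

abbreviation FR_dist where "FR_dist \<equiv> norm_dist (FR G) (FR_norm G N)"

lemma FR_dist_conj_factor_le:
  assumes "h \<in> carrier (FR G)" "g \<in> carrier G" "e \<in> {1, - 1}"
  shows "FR_dist (conj_factor h g r e) (conj_factor h g s e) \<le> \<bar>r - s\<bar> * N g"
proof -
  let ?b = "\<lambda>r. FR_bar G g (of_int e * r)"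
  have closed: "?b r \<in> carrier (FR G)" for r by (rule FR_bar_closed[OF assms(2)])
  have "FR_dist (conj_factor h g r e) (conj_factor h g s e) = FR_dist (?b r) (?b s)"
    unfolding conj_factor_def using assms closed
    by (simp add: FRN.dist_right_mult FRN.dist_left_mult)
  also have "\<dots> = FR_norm G N (FR_conj_prod G [(\<one>\<^bsub>FR G\<^esub>, g, s - r, e)])"
    using assms closed FR_bar_minus[OF assms(2), of "of_int e * r"]
      FR_bar_add[OF assms(2), of "of_int e * (- r)" "of_int e * s"]
    by (simp add: FRN.dist_eq conj_factor_def FR_bar_closed algebra_simps)
  also have "\<dots> \<le> cost [(\<one>\<^bsub>FR G\<^esub>, g, s - r, e)]"
    by (rule FR_norm_le_cost) (use assms in simp)
  finally show ?thesis by (simp add: abs_minus_commute)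
qed

lemma FR_dist_bar_le:
  assumes "g \<in> carrier G"
  shows "FR_dist (FR_bar G g r) (FR_bar G g s) \<le> \<bar>r - s\<bar> * N g"
  using FR_dist_conj_factor_le[of "\<one>\<^bsub>FR G\<^esub>" g 1 r s] assms by (simp add: conj_factor_def FR_bar_closed)

text \<open>Letting \<open>s\<close> run from \<open>0\<close> to \<open>1\<close> gives a path in \<open>F\<^sub>\<real>(G)\<close> that ends at the given product, and its
  speed is at most the cost of the factorization.\<close>

definition scale_factors ::
    "real \<Rightarrow> (('a \<times> real) list set \<times> 'a \<times> real \<times> int) list
      \<Rightarrow> (('a \<times> real) list set \<times> 'a \<times> real \<times> int) list" where
  "scale_factors s = map (\<lambda>(h, g, r, e). (h, g, s * r, e))"

lemma scale_factors_simps [simp]: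
  "scale_factors s [] = []" "scale_factors s ((h, g, r, e) # fs) = (h, g, s * r, e) # scale_factors s fs"
  by (simp_all add: scale_factors_def)

lemma scale_factors_in_lists: "fs \<in> factor_lists \<Longrightarrow> scale_factors s fs \<in> factor_lists"
  by (induction rule: factor_lists_induct) auto

lemma scale_factors_one: "scale_factors 1 fs = fs"
  by (induction fs) auto

lemma FR_norm_scale_zero: "fs \<in> factor_lists \<Longrightarrow> FR_norm G N (FR_conj_prod G (scale_factors 0 fs)) = 0"
proof -
  assume fs: "fs \<in> factor_lists"
  then have "cost (scale_factors 0 fs) = 0" by (induction rule: factor_lists_induct) auto
  then show ?thesis
    using FR_norm_le_cost[OF scale_factors_in_lists[OF fs, of 0]]
      FRN.pnorm_nonneg[OF FR_conj_prod_closed[OF scale_factors_in_lists[OF fs, of 0]]] by simp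
qed

lemma FR_dist_scale_le:
  "fs \<in> factor_lists \<Longrightarrow>
    FR_dist (FR_conj_prod G (scale_factors s fs)) (FR_conj_prod G (scale_factors s' fs)) \<le> cost fs * \<bar>s - s'\<bar>"
proof (induction rule: factor_lists_induct)
  case Nil
  then show ?case by (simp add: FRN.dist_self)
next
  case (Cons h g r e fs)
  let ?P = "\<lambda>s. FR_conj_prod G (scale_factors s fs)" and ?f = "\<lambda>s. conj_factor h g (s * r) e"
  have closed: "?P s \<in> carrier (FR G)" "?f s \<in> carrier (FR G)" for s
    using Cons by (simp_all only: FR_conj_prod_closed scale_factors_in_lists conj_factor_closed)
  have "FR_dist (?f s \<otimes>\<^bsub>FR G\<^esub> ?P s) (?f s' \<otimes>\<^bsub>FR G\<^esub> ?P s') \<le> FR_dist (?f s) (?f s') + FR_dist (?P s) (?P s')"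
    by (rule FRN.dist_mult_le) (rule closed)+
  also have "\<dots> \<le> \<bar>s * r - s' * r\<bar> * N g + cost fs * \<bar>s - s'\<bar>"
    by (intro add_mono FR_dist_conj_factor_le Cons)
  also have "\<dots> = cost ((h, g, r, e) # fs) * \<bar>s - s'\<bar>"
  proof -
    have "\<bar>s * r - s' * r\<bar> = \<bar>r\<bar> * \<bar>s - s'\<bar>"
      by (simp add: left_diff_distrib[symmetric] abs_mult)
    then show ?thesis by (simp add: algebra_simps)
  qed
  finally show ?case
    unfolding scale_factors_simps FR_conj_prod_Cons[OF Cons(2,3)] .
qed

end

section \<open>The pseudonormed group \<open>D(G,T)\<close>\<close>

text \<open>For a diagonal sequence: at time \<open>t\<close> only those indices may be used whose thresholds have been
  passed, and yet every index is used eventually. Taking \<open>k t\<close> at most \<open>t\<close> makes the maximum below one over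
  a finite set.\<close>

lemma slow_index_exists:
  fixes \<tau> :: "nat \<Rightarrow> real"
  obtains k :: "real \<Rightarrow> nat" where "\<And>n t. n < k t \<Longrightarrow> \<tau> n \<le> t" "\<And>m. \<exists>t0. \<forall>t\<ge>t0. m \<le> k t"
proof -
  define A where "A t = {k. k \<le> nat \<lfloor>t\<rfloor> \<and> (\<forall>n<k. \<tau> n \<le> t)}" for t
  have fin: "finite (A t)" for t by (rule finite_subset[of _ "{..nat \<lfloor>t\<rfloor>}"]) (auto simp: A_def)
  have "0 \<in> A t" for t by (simp add: A_def)
  then have max: "Max (A t) \<in> A t" for t using Max_in[OF fin[of t]] by blast
  show ?thesis
  proof (rule that[of "\<lambda>t. Max (A t)"])
    show "\<tau> n \<le> t" if "n < Max (A t)" for n t using max[of t] that by (simp add: A_def)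
    show "\<exists>t0. \<forall>t\<ge>t0. m \<le> Max (A t)" for m
    proof (intro exI allI impI)
      fix t assume t: "real m + (\<Sum>n<m. \<bar>\<tau> n\<bar>) \<le> t"
      have "0 \<le> (\<Sum>n<m. \<bar>\<tau> n\<bar>)" by (simp add: sum_nonneg)
      then have "real m \<le> t" using t by linarith
      then have "m \<le> nat \<lfloor>t\<rfloor>" by linarith
      moreover have "\<tau> n \<le> t" if "n < m" for n
      proof -
        have "\<bar>\<tau> n\<bar> \<le> (\<Sum>n<m. \<bar>\<tau> n\<bar>)" using that by (intro member_le_sum) auto
        then show ?thesis using t by linarith
      qed
      ultimately have "m \<in> A t" by (simp add: A_def)
      then show "m \<le> Max (A t)" using Max_ge[OF fin] by blast
    qed
  qed
qed

locale scaled_normed_group = conj_inv_normed_group +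
  fixes T :: "real set"
  assumes scaling: "scaling_set T"
begin

lemma T_pos: "t \<in> T \<Longrightarrow> 0 < t"
  using scaling by (auto simp: scaling_set_def)

lemma T_unbounded: "\<exists>t\<in>T. t0 \<le> t"
proof (rule ccontr)
  assume "\<not> ?thesis"
  then have "T \<subseteq> {0..t0}" using T_pos by force
  then show False using scaling bounded_subset[OF bounded_closed_interval] by (auto simp: scaling_set_def)
qed

definition along_T :: "real filter" where "along_T = inf at_top (principal T)"

lemma eventually_along_T: "eventually P along_T \<longleftrightarrow> (\<exists>t0. \<forall>t\<in>T. t0 \<le> t \<longrightarrow> P t)"
  by (auto simp: along_T_def eventually_inf_principal eventually_at_top_linorder)

lemma along_T_nontrivial: "along_T \<noteq> bot"
  using T_unbounded by (auto simp: trivial_limit_def eventually_along_T)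

lemma eventually_in_T: "eventually (\<lambda>t. t \<in> T) along_T"
  by (auto simp: eventually_along_T)

text \<open>The scaling set may be discrete or not, so completeness of the reals is used in its filter form.\<close>

lemma along_T_tendsto_if_Cauchy:
  fixes f :: "real \<Rightarrow> real"
  assumes "\<And>e. e > 0 \<Longrightarrow> \<exists>t0. \<forall>t\<in>T. \<forall>t'\<in>T. t \<ge> t0 \<longrightarrow> t' \<ge> t0 \<longrightarrow> \<bar>f t - f t'\<bar> < e"
  shows "\<exists>l. (f \<longlongrightarrow> l) along_T"
proof -
  have "cauchy_filter (filtermap f along_T)"
    unfolding cauchy_filter_metric_filtermap
  proof (intro allI impI)
    fix e :: real assume "e > 0"
    then obtain t0 where t0: "\<forall>t\<in>T. \<forall>t'\<in>T. t \<ge> t0 \<longrightarrow> t' \<ge> t0 \<longrightarrow> \<bar>f t - f t'\<bar> < e"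
      using assms by blast
    then show "\<exists>P. eventually P along_T \<and> (\<forall>x y. P x \<and> P y \<longrightarrow> dist (f x) (f y) < e)"
      by (intro exI[of _ "\<lambda>t. t \<in> T \<and> t0 \<le> t"]) (auto simp: eventually_along_T dist_real_def)
  qed
  then obtain l where "filtermap f along_T \<le> nhds l"
    using cauchy_filter_complete_converges[of "filtermap f along_T" UNIV] complete_UNIV along_T_nontrivial
    by (auto simp: filtermap_bot_iff)
  then show ?thesis by (auto simp: filterlim_def)
qed

abbreviation D_group where "D_group \<equiv> dir_D G N T"
abbreviation D_norm where "D_norm \<equiv> dir_D_norm G N T"
abbreviation D_dist where "D_dist \<equiv> norm_dist D_group D_norm"
abbreviation FZ_power where "FZ_power \<equiv> product_group T (\<lambda>_. FZ G)"

definition rescale :: "(real \<Rightarrow> ('a \<times> real) list set) \<Rightarrow> real \<Rightarrow> ('a \<times> real) list set" where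
  "rescale w t = FR_psi G (1 / t) (w t)"

lemma rescale_closed: "w \<in> carrier FZ_power \<Longrightarrow> t \<in> T \<Longrightarrow> rescale w t \<in> carrier (FR G)"
  by (auto simp: rescale_def intro!: FZ_subset FR_psi.hom_closed)

lemma group_FZ_power: "group FZ_power"
  by (rule product_group) (rule group_FZ)

interpretation FZ_power: group FZ_power by (rule group_FZ_power)

lemma rescale_mult:
  "w \<in> carrier FZ_power \<Longrightarrow> v \<in> carrier FZ_power \<Longrightarrow> t \<in> T \<Longrightarrow>
    rescale (w \<otimes>\<^bsub>FZ_power\<^esub> v) t = rescale w t \<otimes>\<^bsub>FR G\<^esub> rescale v t"
  by (auto simp: rescale_def intro!: FR_psi.hom_mult FZ_subset)

lemma rescale_one: "t \<in> T \<Longrightarrow> rescale \<one>\<^bsub>FZ_power\<^esub> t = \<one>\<^bsub>FR G\<^esub>"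
  by (simp add: rescale_def)

lemma rescale_inv:
  assumes "w \<in> carrier FZ_power" "t \<in> T"
  shows "rescale (inv\<^bsub>FZ_power\<^esub> w) t = inv\<^bsub>FR G\<^esub> (rescale w t)"
proof (rule FR.inv_equality[symmetric])
  show "rescale (inv\<^bsub>FZ_power\<^esub> w) t \<otimes>\<^bsub>FR G\<^esub> rescale w t = \<one>\<^bsub>FR G\<^esub>"
    using rescale_mult[of "inv\<^bsub>FZ_power\<^esub> w" w t] assms rescale_one[OF assms(2)]
    by (simp only: FZ_power.l_inv FZ_power.inv_closed)
qed (use assms rescale_closed FZ_power.inv_closed in blast)+

lemma carrier_D:
  "w \<in> carrier D_group \<longleftrightarrow> w \<in> carrier FZ_power \<and> cauchy_along T FR_dist (rescale w)"
  by (simp add: dir_D_def rescale_def[abs_def])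

text \<open>This puts the diagonal product into \<open>D(G,T)\<close> and, with constant \<open>g\<close>, every function whose
  rescaling converges to an element of \<open>F\<^sub>\<real>(G)\<close>.\<close>

lemma cauchy_along_if_close:
  assumes f: "\<And>t. t \<in> T \<Longrightarrow> f t \<in> carrier (FR G)"
    and close: "\<And>e. e > 0 \<Longrightarrow> \<exists>g. (\<forall>t\<in>T. g t \<in> carrier (FR G)) \<and> cauchy_along T FR_dist g \<and>
        eventually (\<lambda>t. FR_dist (g t) (f t) \<le> e) along_T"
  shows "cauchy_along T FR_dist f"
  unfolding cauchy_along_def
proof (intro allI impI)
  fix e :: real assume "e > 0"
  then obtain g where g: "\<And>t. t \<in> T \<Longrightarrow> g t \<in> carrier (FR G)" "cauchy_along T FR_dist g"
      "eventually (\<lambda>t. FR_dist (g t) (f t) \<le> e/4) along_T"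
    using close[of "e/4"] by auto
  obtain t1 where t1: "\<And>t. t \<in> T \<Longrightarrow> t1 \<le> t \<Longrightarrow> FR_dist (g t) (f t) \<le> e/4"
    using g(3) by (auto simp: eventually_along_T)
  obtain t2 where t2: "\<And>t t'. t \<in> T \<Longrightarrow> t' \<in> T \<Longrightarrow> t2 \<le> t \<Longrightarrow> t2 \<le> t' \<Longrightarrow> FR_dist (g t) (g t') < e/2"
    using g(2) half_gt_zero[OF \<open>e > 0\<close>] unfolding cauchy_along_def by meson
  show "\<exists>t0. \<forall>t\<in>T. \<forall>t'\<in>T. t0 \<le> t \<longrightarrow> t0 \<le> t' \<longrightarrow> FR_dist (f t) (f t') < e"
  proof (intro exI[of _ "max t1 t2"] ballI impI)
    fix t t' assume t: "t \<in> T" "t' \<in> T" "max t1 t2 \<le> t" "max t1 t2 \<le> t'"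
    have "FR_dist (f t) (f t') \<le> FR_dist (f t) (g t) + FR_dist (g t) (g t') + FR_dist (g t') (f t')"
      using FRN.dist_triangle[of "f t" "g t" "f t'"] FRN.dist_triangle[of "g t" "g t'" "f t'"]
        f g(1) t by fastforce
    then show "FR_dist (f t) (f t') < e"
      using t1[of t] t1[of t'] t2[of t t'] t FRN.dist_commute[of "f t" "g t"] by simp
  qed
qed

lemma subgroup_D: "subgroup (carrier D_group) FZ_power"
proof (rule FZ_power.subgroupI)
  show "carrier D_group \<subseteq> carrier FZ_power" using carrier_D by blast
  have "\<one>\<^bsub>FZ_power\<^esub> \<in> carrier D_group"
    unfolding carrier_D cauchy_along_def using FZ_power.one_closed
    by (simp add: rescale_one FRN.dist_self del: one_product_group carrier_product_group)
  then show "carrier D_group \<noteq> {}" by blast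
next
  fix w assume w: "w \<in> carrier D_group"
  show "inv\<^bsub>FZ_power\<^esub> w \<in> carrier D_group"
    using w FZ_power.inv_closed[of w] unfolding carrier_D cauchy_along_def
    by (simp add: rescale_inv FRN.dist_inv_inv rescale_closed del: inv_product_group carrier_product_group)
next
  fix w v assume wv: "w \<in> carrier D_group" "v \<in> carrier D_group"
  then have wv': "w \<in> carrier FZ_power" "v \<in> carrier FZ_power" by (simp_all only: carrier_D)
  have "cauchy_along T FR_dist (rescale (w \<otimes>\<^bsub>FZ_power\<^esub> v))"
    unfolding cauchy_along_def
  proof (intro allI impI)
    fix e :: real assume "e > 0"
    obtain t1 where t1: "\<And>t t'. t \<in> T \<Longrightarrow> t' \<in> T \<Longrightarrow> t1 \<le> t \<Longrightarrow> t1 \<le> t' \<Longrightarrow> FR_dist (rescale w t) (rescale w t') < e/2"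
      using wv(1) half_gt_zero[OF \<open>e > 0\<close>] unfolding carrier_D cauchy_along_def by meson
    obtain t2 where t2: "\<And>t t'. t \<in> T \<Longrightarrow> t' \<in> T \<Longrightarrow> t2 \<le> t \<Longrightarrow> t2 \<le> t' \<Longrightarrow> FR_dist (rescale v t) (rescale v t') < e/2"
      using wv(2) half_gt_zero[OF \<open>e > 0\<close>] unfolding carrier_D cauchy_along_def by meson
    show "\<exists>t0. \<forall>t\<in>T. \<forall>t'\<in>T. t0 \<le> t \<longrightarrow> t0 \<le> t' \<longrightarrow>
        FR_dist (rescale (w \<otimes>\<^bsub>FZ_power\<^esub> v) t) (rescale (w \<otimes>\<^bsub>FZ_power\<^esub> v) t') < e"
    proof (intro exI[of _ "max t1 t2"] ballI impI)
      fix t t' assume t: "t \<in> T" "t' \<in> T" "max t1 t2 \<le> t" "max t1 t2 \<le> t'"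
      have "FR_dist (rescale w t \<otimes>\<^bsub>FR G\<^esub> rescale v t) (rescale w t' \<otimes>\<^bsub>FR G\<^esub> rescale v t')
          \<le> FR_dist (rescale w t) (rescale w t') + FR_dist (rescale v t) (rescale v t')"
        by (intro FRN.dist_mult_le rescale_closed wv' t)
      then show "FR_dist (rescale (w \<otimes>\<^bsub>FZ_power\<^esub> v) t) (rescale (w \<otimes>\<^bsub>FZ_power\<^esub> v) t') < e"
        using t1[of t t'] t2[of t t'] t unfolding rescale_mult[OF wv' t(1)] rescale_mult[OF wv' t(2)] by simp
    qed
  qed
  then show "w \<otimes>\<^bsub>FZ_power\<^esub> v \<in> carrier D_group"
    using FZ_power.m_closed[OF wv'] unfolding carrier_D by blast
qed

lemma D_group_eq: "D_group = FZ_power\<lparr>carrier := carrier D_group\<rparr>"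
  by (simp add: dir_D_def)

lemma group_D: "group D_group"
  using FZ_power.subgroup_imp_group[OF subgroup_D] D_group_eq by simp

interpretation D: group D_group by (rule group_D)

lemma D_mult: "w \<otimes>\<^bsub>D_group\<^esub> v = w \<otimes>\<^bsub>FZ_power\<^esub> v"
  by (simp add: dir_D_def)

lemma D_one: "\<one>\<^bsub>D_group\<^esub> = \<one>\<^bsub>FZ_power\<^esub>"
  by (simp add: dir_D_def)

lemma D_subset: "w \<in> carrier D_group \<Longrightarrow> w \<in> carrier FZ_power"
  by (simp only: carrier_D)

lemma D_inv:
  assumes "w \<in> carrier D_group"
  shows "inv\<^bsub>D_group\<^esub> w = inv\<^bsub>FZ_power\<^esub> w"
proof (rule FZ_power.inv_equality[symmetric])
  show "inv\<^bsub>D_group\<^esub> w \<otimes>\<^bsub>FZ_power\<^esub> w = \<one>\<^bsub>FZ_power\<^esub>"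
    using D.l_inv[OF assms] unfolding D_mult D_one .
qed (rule D_subset, simp add: assms)+

lemma rescale_D_mult:
  assumes "w \<in> carrier D_group" "v \<in> carrier D_group" "t \<in> T"
  shows "rescale (w \<otimes>\<^bsub>D_group\<^esub> v) t = rescale w t \<otimes>\<^bsub>FR G\<^esub> rescale v t"
  unfolding D_mult by (intro rescale_mult D_subset assms)

lemma rescale_D_inv:
  assumes "w \<in> carrier D_group" "t \<in> T"
  shows "rescale (inv\<^bsub>D_group\<^esub> w) t = inv\<^bsub>FR G\<^esub> (rescale w t)"
  unfolding D_inv[OF assms(1)] by (intro rescale_inv D_subset assms)

lemma rescale_D_one: "t \<in> T \<Longrightarrow> rescale \<one>\<^bsub>D_group\<^esub> t = \<one>\<^bsub>FR G\<^esub>"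
  unfolding D_one by (rule rescale_one)

lemma rescale_D_closed: "w \<in> carrier D_group \<Longrightarrow> t \<in> T \<Longrightarrow> rescale w t \<in> carrier (FR G)"
  by (intro rescale_closed D_subset)

lemma D_norm_tendsto:
  assumes w: "w \<in> carrier D_group"
  shows "((\<lambda>t. FR_norm G N (rescale w t)) \<longlongrightarrow> D_norm w) along_T"
proof -
  have "\<exists>l. ((\<lambda>t. FR_norm G N (rescale w t)) \<longlongrightarrow> l) along_T"
  proof (rule along_T_tendsto_if_Cauchy)
    fix e :: real assume "e > 0"
    then obtain t0 where t0: "\<And>t t'. t \<in> T \<Longrightarrow> t' \<in> T \<Longrightarrow> t0 \<le> t \<Longrightarrow> t0 \<le> t' \<Longrightarrow> FR_dist (rescale w t) (rescale w t') < e"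
      using w unfolding carrier_D cauchy_along_def by meson
    have "\<bar>FR_norm G N (rescale w t) - FR_norm G N (rescale w t')\<bar> < e"
      if "t \<in> T" "t' \<in> T" "t0 \<le> t" "t0 \<le> t'" for t t'
      using t0[OF that] FRN.norm_diff_le_dist[of "rescale w t" "rescale w t'"] rescale_D_closed[OF w] that
      by fastforce
    then show "\<exists>t0. \<forall>t\<in>T. \<forall>t'\<in>T. t0 \<le> t \<longrightarrow> t0 \<le> t' \<longrightarrow>
        \<bar>FR_norm G N (rescale w t) - FR_norm G N (rescale w t')\<bar> < e" by blast
  qed
  then obtain l where l: "((\<lambda>t. FR_norm G N (rescale w t)) \<longlongrightarrow> l) along_T" by blast
  have "D_norm w = l"
    using tendsto_Lim[OF along_T_nontrivial l] by (simp add: dir_D_norm_def along_T_def rescale_def)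
  then show ?thesis using l by simp
qed

lemma D_norm_eqI:
  assumes "w \<in> carrier D_group" "(f \<longlongrightarrow> l) along_T" "\<And>t. t \<in> T \<Longrightarrow> FR_norm G N (rescale w t) = f t"
  shows "D_norm w = l"
proof (rule tendsto_unique[OF along_T_nontrivial D_norm_tendsto[OF assms(1)]])
  have "eventually (\<lambda>t. FR_norm G N (rescale w t) = f t) along_T"
    using eventually_in_T by eventually_elim (rule assms(3))
  then show "((\<lambda>t. FR_norm G N (rescale w t)) \<longlongrightarrow> l) along_T"
    using assms(2) by (simp add: tendsto_cong)
qed

lemma D_norm_pseudonormed: "conj_inv_pseudonormed_group D_group D_norm"
proof unfold_locales
  fix w assume w: "w \<in> carrier D_group"
  show "0 \<le> D_norm w"
  proof (rule tendsto_lowerbound[OF D_norm_tendsto[OF w] _ along_T_nontrivial])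
    show "eventually (\<lambda>t. 0 \<le> FR_norm G N (rescale w t)) along_T"
      using eventually_in_T by eventually_elim (rule FRN.pnorm_nonneg[OF rescale_D_closed[OF w]])
  qed
  show "D_norm (inv\<^bsub>D_group\<^esub> w) = D_norm w"
    by (rule D_norm_eqI[OF D.inv_closed[OF w] D_norm_tendsto[OF w]])
      (simp add: rescale_D_inv[OF w] FRN.pnorm_inv rescale_D_closed[OF w])
  fix v assume v: "v \<in> carrier D_group"
  show "D_norm (w \<otimes>\<^bsub>D_group\<^esub> v) \<le> D_norm w + D_norm v"
  proof (rule tendsto_le[OF along_T_nontrivial tendsto_add[OF D_norm_tendsto[OF w] D_norm_tendsto[OF v]]
        D_norm_tendsto[OF D.m_closed[OF w v]]])
    show "eventually (\<lambda>t. FR_norm G N (rescale (w \<otimes>\<^bsub>D_group\<^esub> v) t)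
        \<le> FR_norm G N (rescale w t) + FR_norm G N (rescale v t)) along_T"
      using eventually_in_T
    proof eventually_elim
      case (elim t)
      then show ?case
        unfolding rescale_D_mult[OF w v elim] by (intro FRN.pnorm_mult_le rescale_D_closed w v)
    qed
  qed
  show "D_norm (v \<otimes>\<^bsub>D_group\<^esub> w \<otimes>\<^bsub>D_group\<^esub> inv\<^bsub>D_group\<^esub> v) = D_norm w"
  proof (rule D_norm_eqI[OF _ D_norm_tendsto[OF w]])
    show "v \<otimes>\<^bsub>D_group\<^esub> w \<otimes>\<^bsub>D_group\<^esub> inv\<^bsub>D_group\<^esub> v \<in> carrier D_group" using w v by simp
    show "FR_norm G N (rescale (v \<otimes>\<^bsub>D_group\<^esub> w \<otimes>\<^bsub>D_group\<^esub> inv\<^bsub>D_group\<^esub> v) t) = FR_norm G N (rescale w t)"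
      if "t \<in> T" for t
      using that v w by (simp add: rescale_D_mult rescale_D_inv FRN.pnorm_conj rescale_D_closed)
  qed
next
  show "D_norm \<one>\<^bsub>D_group\<^esub> = 0"
    by (rule D_norm_eqI[OF D.one_closed tendsto_const]) (simp add: rescale_D_one FRN.pnorm_one)
qed

interpretation DN: conj_inv_pseudonormed_group D_group D_norm by (rule D_norm_pseudonormed)

lemma D_dist_tendsto:
  assumes "w \<in> carrier D_group" "v \<in> carrier D_group"
  shows "((\<lambda>t. FR_dist (rescale w t) (rescale v t)) \<longlongrightarrow> D_dist w v) along_T"
proof -
  have "eventually (\<lambda>t. FR_norm G N (rescale (inv\<^bsub>D_group\<^esub> w \<otimes>\<^bsub>D_group\<^esub> v) t) = FR_dist (rescale w t) (rescale v t)) along_T"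
    using eventually_in_T
    by eventually_elim (simp add: assms rescale_D_mult rescale_D_inv FRN.dist_eq rescale_D_closed)
  then show ?thesis
    using D_norm_tendsto[of "inv\<^bsub>D_group\<^esub> w \<otimes>\<^bsub>D_group\<^esub> v"] assms
    by (simp add: DN.dist_eq tendsto_cong)
qed

lemma D_dist_le:
  assumes "w \<in> carrier D_group" "v \<in> carrier D_group"
    "(f \<longlongrightarrow> c) along_T" "eventually (\<lambda>t. FR_dist (rescale w t) (rescale v t) \<le> f t) along_T"
  shows "D_dist w v \<le> c"
  by (rule tendsto_le[OF along_T_nontrivial assms(3) D_dist_tendsto[OF assms(1,2)] assms(4)])

section \<open>Convergence of fast products in \<open>D(G,T)\<close>\<close>

text \<open>At time \<open>t\<close> the limit is the partial product of length \<open>k t\<close>, where only factors are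
  included whose rescaled value at time \<open>t\<close> already obeys the bound \<open>2\<^sup>-\<^sup>n\<close>. So it stays
  within \<open>2 \<cdot> 2\<^sup>-\<^sup>m\<close> of the \<open>m\<close>-th partial product as soon as \<open>k t\<close> exceeds \<open>m\<close>.\<close>

lemma D_fast_products_converge: "fast_products_converge D_group D_norm"
  unfolding fast_products_converge_def
proof (intro allI impI)
  fix u assume u: "\<forall>n. u n \<in> carrier D_group \<and> D_norm (u n) < (1/2)^n"
  then have uc: "u n \<in> carrier D_group" for n by blast
  define P where "P n = partial_prod D_group u n" for n
  have P: "P n \<in> carrier D_group" for n unfolding P_def by (rule D.partial_prod_closed) (rule uc)
  have "\<forall>n. \<exists>t0. \<forall>t\<in>T. t0 \<le> t \<longrightarrow> FR_norm G N (rescale (u n) t) < (1/2)^n"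
    using order_tendstoD(2)[OF D_norm_tendsto[OF uc]] u by (simp add: eventually_along_T)
  then obtain \<tau> where \<tau>: "\<And>n t. t \<in> T \<Longrightarrow> \<tau> n \<le> t \<Longrightarrow> FR_norm G N (rescale (u n) t) < (1/2)^n"
    by metis
  obtain k where k: "\<And>n t. n < k t \<Longrightarrow> \<tau> n \<le> t" "\<And>m. \<exists>t0. \<forall>t\<ge>t0. m \<le> k t"
    using slow_index_exists[of \<tau>] by blast
  define x where "x = (\<lambda>t\<in>T. P (k t) t)"
  have x: "x \<in> carrier FZ_power" using D_subset[OF P] by (auto simp: x_def)
  have step: "FR_dist (rescale (P m) t) (rescale (P n) t) \<le> 2 * (1/2)^m - 2 * (1/2)^n"
    if "t \<in> T" "m \<le> n" "n \<le> k t" for t m n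
    using that(2,3)
  proof (induction rule: dec_induct)
    case base
    then show ?case by (simp add: FRN.dist_self)
  next
    case (step n)
    have "FR_dist (rescale (P n) t) (rescale (P (Suc n)) t) = FR_norm G N (rescale (u n) t)"
      using FRN.dist_left_mult[of "rescale (P n) t" "\<one>\<^bsub>FR G\<^esub>" "rescale (u n) t"]
        rescale_D_closed[OF P that(1), of n] rescale_D_closed[OF uc that(1), of n]
        rescale_D_mult[OF P uc that(1), of n n]
      by (simp add: P_def FRN.dist_one_left)
    also have "\<dots> < (1/2)^n" using \<tau>[OF that(1) k(1)] step by simp
    finally show ?case
      using FRN.dist_triangle[OF rescale_D_closed[OF P that(1), of m] rescale_D_closed[OF P that(1), of n]
          rescale_D_closed[OF P that(1), of "Suc n"]] step by simp
  qed
  have close: "eventually (\<lambda>t. FR_dist (rescale (P m) t) (rescale x t) \<le> 2 * (1/2)^m) along_T" for m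
  proof -
    obtain t0 where t0: "\<And>t. t0 \<le> t \<Longrightarrow> m \<le> k t" using k(2) by blast
    have "FR_dist (rescale (P m) t) (rescale x t) \<le> 2 * (1/2)^m" if "t \<in> T" "t0 \<le> t" for t
    proof -
      have x_eq: "rescale x t = rescale (P (k t)) t" using that by (simp add: rescale_def x_def)
      have "0 \<le> (1/2::real) ^ k t" by simp
      then show ?thesis
        unfolding x_eq using step[OF that(1) t0[OF that(2)] order_refl] by linarith
    qed
    then show ?thesis by (auto simp: eventually_along_T)
  qed
  have lim: "(\<lambda>m. 2 * (1/2)^m :: real) \<longlonglongrightarrow> 0"
    by (intro tendsto_mult_right_zero LIMSEQ_realpow_zero) auto
  have "cauchy_along T FR_dist (rescale x)"
  proof (rule cauchy_along_if_close)
    show "rescale x t \<in> carrier (FR G)" if "t \<in> T" for t by (rule rescale_closed[OF x that])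
    fix e :: real assume "e > 0"
    then obtain m where m: "2 * (1/2)^m < e"
      using order_tendstoD(2)[OF lim] eventually_happens'[OF sequentially_bot] by blast
    show "\<exists>g. (\<forall>t\<in>T. g t \<in> carrier (FR G)) \<and> cauchy_along T FR_dist g \<and>
        eventually (\<lambda>t. FR_dist (g t) (rescale x t) \<le> e) along_T"
    proof (intro exI[of _ "rescale (P m)"] conjI ballI)
      show "rescale (P m) t \<in> carrier (FR G)" if "t \<in> T" for t by (rule rescale_D_closed[OF P that])
      show "cauchy_along T FR_dist (rescale (P m))" using P carrier_D by blast
      show "eventually (\<lambda>t. FR_dist (rescale (P m) t) (rescale x t) \<le> e) along_T"
        using close[of m] by eventually_elim (use m in linarith)
    qed
  qed
  then have xD: "x \<in> carrier D_group" using x carrier_D by blast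
  have "D_dist (P m) x \<le> 2 * (1/2)^m" for m
    by (rule D_dist_le[OF P xD tendsto_const close])
  then have "(\<lambda>m. D_dist (P m) x) \<longlonglongrightarrow> 0"
    by (intro tendsto_sandwich[OF _ _ tendsto_const lim]) (auto simp: DN.dist_nonneg)
  then show "\<exists>x\<in>carrier D_group. (\<lambda>n. D_dist (partial_prod D_group u n) x) \<longlonglongrightarrow> 0"
    using xD by (auto simp: P_def)
qed

section \<open>Almost geodesics in \<open>D(G,T)\<close>\<close>

text \<open>Rounding \<open>t r\<close> to an integer costs at most \<open>\<parallel>g\<parallel>\<close>, which becomes \<open>\<parallel>g\<parallel> / t\<close> after rescaling.\<close>

lemma discretization_tendsto: "((\<lambda>t. FR_dist (FR_bar G g r) (FR_bar G g (of_int \<lfloor>t * r\<rfloor> / t))) \<longlongrightarrow> 0) along_T"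
  if g: "g \<in> carrier G"
proof (rule tendsto_sandwich[OF _ _ tendsto_const])
  show "eventually (\<lambda>t. FR_dist (FR_bar G g r) (FR_bar G g (of_int \<lfloor>t * r\<rfloor> / t)) \<le> inverse t * N g) along_T"
    using eventually_in_T
  proof eventually_elim
    case (elim t)
    have "0 < t" by (rule T_pos[OF elim])
    have "\<bar>t * r - of_int \<lfloor>t * r\<rfloor>\<bar> \<le> 1" by linarith
    moreover have "\<bar>r - of_int \<lfloor>t * r\<rfloor> / t\<bar> = \<bar>t * r - of_int \<lfloor>t * r\<rfloor>\<bar> / t"
    proof -
      have "r - of_int \<lfloor>t * r\<rfloor> / t = (t * r - of_int \<lfloor>t * r\<rfloor>) / t" using \<open>0 < t\<close> by (simp add: field_simps)
      then show ?thesis using \<open>0 < t\<close> by (simp add: abs_divide)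
    qed
    ultimately have "\<bar>r - of_int \<lfloor>t * r\<rfloor> / t\<bar> \<le> inverse t"
      using \<open>0 < t\<close> by (simp add: divide_right_mono inverse_eq_divide)
    then have "\<bar>r - of_int \<lfloor>t * r\<rfloor> / t\<bar> * N g \<le> inverse t * N g"
      by (rule mult_right_mono) (rule norm_nonneg[OF g])
    then show ?case using FR_dist_bar_le[OF g, of r "of_int \<lfloor>t * r\<rfloor> / t"] by linarith
  qed
  have "(inverse \<longlongrightarrow> (0::real)) along_T"
    unfolding along_T_def by (rule tendsto_mono[OF inf_le1 tendsto_inverse_0_at_top[OF filterlim_ident]])
  then show "((\<lambda>t. inverse t * N g) \<longlongrightarrow> 0) along_T" by (rule tendsto_mult_left_zero)
qed (simp add: FRN.dist_nonneg)

text \<open>\<open>F\<^sub>\<real>(G)\<close> maps to \<open>D(G,T)\<close> up to pseudonorm zero: round each letter \<open>g(r)\<close> of a word to \<open>g(\<lfloor>t r\<rfloor>)\<close>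
  at time \<open>t\<close>.\<close>

lemma FR_approximable:
  assumes "y \<in> carrier (FR G)"
  shows "\<exists>w\<in>carrier D_group. ((\<lambda>t. FR_dist y (rescale w t)) \<longlongrightarrow> 0) along_T"
proof -
  have "\<exists>w\<in>carrier FZ_power. ((\<lambda>t. FR_dist y (rescale w t)) \<longlongrightarrow> 0) along_T"
    using assms
  proof (induction rule: FR_induct)
    case one
    have "eventually (\<lambda>t. FR_dist \<one>\<^bsub>FR G\<^esub> (rescale \<one>\<^bsub>FZ_power\<^esub> t) = 0) along_T"
      using eventually_in_T by eventually_elim (simp only: rescale_one FRN.dist_self)
    then have "((\<lambda>t. FR_dist \<one>\<^bsub>FR G\<^esub> (rescale \<one>\<^bsub>FZ_power\<^esub> t)) \<longlongrightarrow> 0) along_T"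
      by (rule tendsto_eventually)
    then show ?case using FZ_power.one_closed by blast
  next
    case (mult g r y)
    then obtain w where w: "w \<in> carrier FZ_power" "((\<lambda>t. FR_dist y (rescale w t)) \<longlongrightarrow> 0) along_T" by blast
    let ?b = "\<lambda>t\<in>T. FR_bar G g (of_int \<lfloor>t * r\<rfloor>)"
    have b: "?b \<in> carrier FZ_power" using FZ_bar_int[OF mult(1)] by auto
    have "((\<lambda>t. FR_dist (FR_bar G g r \<otimes>\<^bsub>FR G\<^esub> y) (rescale (?b \<otimes>\<^bsub>FZ_power\<^esub> w) t)) \<longlongrightarrow> 0) along_T"
    proof (rule tendsto_sandwich[OF _ _ tendsto_const])
      show "((\<lambda>t. FR_dist (FR_bar G g r) (FR_bar G g (of_int \<lfloor>t * r\<rfloor> / t)) + FR_dist y (rescale w t)) \<longlongrightarrow> 0) along_T"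
        using tendsto_add[OF discretization_tendsto[OF mult(1)] w(2)] by simp
      show "eventually (\<lambda>t. FR_dist (FR_bar G g r \<otimes>\<^bsub>FR G\<^esub> y) (rescale (?b \<otimes>\<^bsub>FZ_power\<^esub> w) t)
          \<le> FR_dist (FR_bar G g r) (FR_bar G g (of_int \<lfloor>t * r\<rfloor> / t)) + FR_dist y (rescale w t)) along_T"
        using eventually_in_T
      proof eventually_elim
        case (elim t)
        have "rescale ?b t = FR_bar G g (of_int \<lfloor>t * r\<rfloor> / t)"
          using elim by (simp add: rescale_def FR_psi_bar[OF mult(1)])
        then have "rescale (?b \<otimes>\<^bsub>FZ_power\<^esub> w) t = FR_bar G g (of_int \<lfloor>t * r\<rfloor> / t) \<otimes>\<^bsub>FR G\<^esub> rescale w t"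
          unfolding rescale_mult[OF b w(1) elim] by simp
        then show ?case
          by (simp only:) (intro FRN.dist_mult_le FR_bar_closed mult rescale_closed[OF w(1) elim])
      qed
    qed (simp add: FRN.dist_nonneg)
    then show ?case using FZ_power.m_closed[OF b w(1)] by blast
  qed
  then obtain w where w: "w \<in> carrier FZ_power" "((\<lambda>t. FR_dist y (rescale w t)) \<longlongrightarrow> 0) along_T" by blast
  have "cauchy_along T FR_dist (rescale w)"
  proof (rule cauchy_along_if_close)
    show "rescale w t \<in> carrier (FR G)" if "t \<in> T" for t by (rule rescale_closed[OF w(1) that])
    fix e :: real assume "e > 0"
    have "eventually (\<lambda>t. FR_dist y (rescale w t) \<le> e) along_T"
      using order_tendstoD(2)[OF w(2) \<open>e > 0\<close>] by eventually_elim simp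
    moreover have "cauchy_along T FR_dist (\<lambda>_. y)" by (simp add: cauchy_along_def FRN.dist_self)
    ultimately show "\<exists>g. (\<forall>t\<in>T. g t \<in> carrier (FR G)) \<and> cauchy_along T FR_dist g \<and>
        eventually (\<lambda>t. FR_dist (g t) (rescale w t) \<le> e) along_T"
      using assms by (intro exI[of _ "\<lambda>_. y"]) simp
  qed
  then show ?thesis using w carrier_D by blast
qed

text \<open>By the Cauchy property \<open>w\<close> is close to the constant \<open>\<psi>\<^sub>1\<^sub>/\<^sub>t w(t)\<close> for a fixed large \<open>t\<close>. The path
  in \<open>F\<^sub>\<real>(G)\<close> obtained by scaling the factors of this constant is approximated pointwise in \<open>D(G,T)\<close>, which
  preserves distances.\<close>

lemma D_has_almost_geodesics: "has_almost_geodesics D_group D_norm"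
  unfolding has_almost_geodesics_def
proof (intro ballI allI impI)
  fix w and \<epsilon> :: real assume w: "w \<in> carrier D_group" and "\<epsilon> > 0"
  define \<delta> where "\<delta> = \<epsilon> / 2"
  have \<delta>: "\<delta> > 0" using \<open>\<epsilon> > 0\<close> by (simp add: \<delta>_def)
  obtain t1 where t1: "\<And>t t'. t \<in> T \<Longrightarrow> t' \<in> T \<Longrightarrow> t1 \<le> t \<Longrightarrow> t1 \<le> t' \<Longrightarrow> FR_dist (rescale w t) (rescale w t') < \<delta>"
    using w \<delta> unfolding carrier_D cauchy_along_def by meson
  have "eventually (\<lambda>t. FR_norm G N (rescale w t) < D_norm w + \<delta>) along_T"
    by (rule order_tendstoD(2)[OF D_norm_tendsto[OF w]]) (use \<delta> in simp)
  then obtain t2 where t2: "\<And>t. t \<in> T \<Longrightarrow> t2 \<le> t \<Longrightarrow> FR_norm G N (rescale w t) < D_norm w + \<delta>"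
    by (auto simp: eventually_along_T)
  obtain t0 where t0: "t0 \<in> T" "max t1 t2 \<le> t0" using T_unbounded by blast
  have y: "rescale w t0 \<in> carrier (FR G)" by (rule rescale_D_closed[OF w t0(1)])
  have "FR_norm G N (rescale w t0) < D_norm w + \<delta>" using t2[of t0] t0 by simp
  then obtain fs where fs: "fs \<in> factor_lists" "rescale w t0 = FR_conj_prod G fs" "cost fs < D_norm w + \<delta>"
    by (rule FR_norm_less_obtains[OF y])
  define y where "y s = FR_conj_prod G (scale_factors s fs)" for s
  have yc: "y s \<in> carrier (FR G)" for s
    unfolding y_def by (intro FR_conj_prod_closed scale_factors_in_lists fs)
  have "\<forall>s. \<exists>v. v \<in> carrier D_group \<and> ((\<lambda>t. FR_dist (y s) (rescale v t)) \<longlongrightarrow> 0) along_T"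
    using FR_approximable[OF yc] by blast
  then obtain \<gamma> where \<gamma>: "\<And>s. \<gamma> s \<in> carrier D_group"
      "\<And>s. ((\<lambda>t. FR_dist (y s) (rescale (\<gamma> s) t)) \<longlongrightarrow> 0) along_T" by metis
  show "\<exists>\<gamma> L. \<gamma> \<in> {0..1} \<rightarrow> carrier D_group \<and> D_norm (\<gamma> 0) = 0 \<and>
        (\<forall>s\<in>{0..1::real}. \<forall>s'\<in>{0..1}. D_dist (\<gamma> s) (\<gamma> s') \<le> L * \<bar>s - s'\<bar>) \<and>
        L < D_norm w + \<epsilon> \<and> D_dist (\<gamma> 1) w < \<epsilon>"
  proof (intro exI[of _ \<gamma>] exI[of _ "cost fs"] conjI ballI)
    show "\<gamma> \<in> {0..1} \<rightarrow> carrier D_group" using \<gamma>(1) by blast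
    show "cost fs < D_norm w + \<epsilon>" using fs(3) \<open>\<epsilon> > 0\<close> by (simp add: \<delta>_def)
  next
    have "D_norm (\<gamma> 0) \<le> 0"
    proof (rule tendsto_le[OF along_T_nontrivial \<gamma>(2)[of 0] D_norm_tendsto[OF \<gamma>(1)]])
      show "eventually (\<lambda>t. FR_norm G N (rescale (\<gamma> 0) t) \<le> FR_dist (y 0) (rescale (\<gamma> 0) t)) along_T"
        using eventually_in_T
      proof eventually_elim
        case (elim t)
        have "FR_norm G N (y 0) = 0" unfolding y_def by (rule FR_norm_scale_zero[OF fs(1)])
        then show ?case
          using FRN.norm_diff_le_dist[OF yc[of 0] rescale_D_closed[OF \<gamma>(1) elim, of 0]] by linarith
      qed
    qed
    then show "D_norm (\<gamma> 0) = 0" using DN.pnorm_nonneg[OF \<gamma>(1)[of 0]] by simp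
  next
    fix s s' :: real
    show "D_dist (\<gamma> s) (\<gamma> s') \<le> cost fs * \<bar>s - s'\<bar>"
    proof (rule D_dist_le[OF \<gamma>(1) \<gamma>(1)])
      show "((\<lambda>t. FR_dist (y s) (rescale (\<gamma> s) t) + cost fs * \<bar>s - s'\<bar> + FR_dist (y s') (rescale (\<gamma> s') t))
          \<longlongrightarrow> cost fs * \<bar>s - s'\<bar>) along_T"
        using tendsto_add[OF tendsto_add[OF \<gamma>(2)[of s] tendsto_const] \<gamma>(2)[of s']] by simp
      show "eventually (\<lambda>t. FR_dist (rescale (\<gamma> s) t) (rescale (\<gamma> s') t)
          \<le> FR_dist (y s) (rescale (\<gamma> s) t) + cost fs * \<bar>s - s'\<bar> + FR_dist (y s') (rescale (\<gamma> s') t)) along_T"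
        using eventually_in_T
      proof eventually_elim
        case (elim t)
        have c: "rescale (\<gamma> s) t \<in> carrier (FR G)" "rescale (\<gamma> s') t \<in> carrier (FR G)"
          by (rule rescale_D_closed[OF \<gamma>(1) elim])+
        have "FR_dist (y s) (y s') \<le> cost fs * \<bar>s - s'\<bar>"
          unfolding y_def by (rule FR_dist_scale_le[OF fs(1)])
        then show ?case
          using FRN.dist_triangle[OF c(1) yc[of s] c(2)] FRN.dist_triangle[OF yc[of s] yc[of s'] c(2)]
            FRN.dist_commute[of "y s" "rescale (\<gamma> s) t"] by linarith
      qed
    qed
  next
    have "D_dist (\<gamma> 1) w \<le> \<delta>"
    proof (rule D_dist_le[OF \<gamma>(1) w])
      show "((\<lambda>t. FR_dist (y 1) (rescale (\<gamma> 1) t) + \<delta>) \<longlongrightarrow> \<delta>) along_T"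
        using tendsto_add[OF \<gamma>(2)[of 1] tendsto_const] by simp
      have "FR_dist (rescale (\<gamma> 1) t) (rescale w t) \<le> FR_dist (y 1) (rescale (\<gamma> 1) t) + \<delta>"
        if t: "t \<in> T" "t1 \<le> t" for t
      proof -
        have y1: "y 1 = rescale w t0" by (simp add: y_def scale_factors_one fs(2))
        have "FR_dist (y 1) (rescale w t) < \<delta>" unfolding y1 by (rule t1) (use t0 t in auto)
        then show ?thesis
          using FRN.dist_triangle[OF rescale_D_closed[OF \<gamma>(1) t(1), of 1] yc[of 1] rescale_D_closed[OF w t(1)]]
            FRN.dist_commute[of "y 1" "rescale (\<gamma> 1) t"] by linarith
      qed
      then show "eventually (\<lambda>t. FR_dist (rescale (\<gamma> 1) t) (rescale w t) \<le> FR_dist (y 1) (rescale (\<gamma> 1) t) + \<delta>) along_T"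
        by (auto simp: eventually_along_T)
    qed
    then show "D_dist (\<gamma> 1) w < \<epsilon>" using \<open>\<epsilon> > 0\<close> by (simp add: \<delta>_def)
  qed
qed

section \<open>The cone as a quotient of \<open>D(G,T)\<close>\<close>

abbreviation C_group where "C_group \<equiv> dir_C G N T"
abbreviation C_norm where "C_norm \<equiv> dir_C_norm G N T"

text \<open>Composition with \<open>\<pi>\<close> is a homomorphism onto \<open>C(G,T)\<close>, and the pseudonorm there is by definition the
  infimum over its fibres.\<close>

lemma dir_C_quotient:
  shows dir_C_norm_quotient_map: "norm_quotient_map D_group D_norm C_group C_norm (compose T (FZ_pi G))"
    and dir_C_pseudonormed: "conj_inv_pseudonormed_group C_group C_norm"
proof -
  let ?q = "compose T (FZ_pi G)" and ?GT = "product_group T (\<lambda>_. G)"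
  interpret GT: group ?GT by (rule product_group) (rule is_group)
  interpret pi: group_hom "FZ G" G "FZ_pi G"
    using FZ_pi_exists by (simp add: group_hom_def group_hom_axioms_def group_FZ is_group)
  have "?q \<in> hom D_group ?GT"
  proof (rule homI)
    fix w v assume "w \<in> carrier D_group" "v \<in> carrier D_group"
    then have wv: "\<And>t. t \<in> T \<Longrightarrow> w t \<in> carrier (FZ G)" "\<And>t. t \<in> T \<Longrightarrow> v t \<in> carrier (FZ G)"
      using D_subset by (auto dest!: D_subset)
    show "?q w \<in> carrier ?GT" using wv by (auto simp: compose_def)
    have "FZ_pi G (w t \<otimes>\<^bsub>FR G\<^esub> v t) = FZ_pi G (w t) \<otimes> FZ_pi G (v t)" if "t \<in> T" for t
      using pi.hom_mult[OF wv(1)[OF that] wv(2)[OF that]] by simp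
    then show "?q (w \<otimes>\<^bsub>D_group\<^esub> v) = ?q w \<otimes>\<^bsub>?GT\<^esub> ?q v"
      by (auto simp: D_mult compose_def)
  qed
  then interpret q: group_hom D_group ?GT ?q
    by (simp add: group_hom_def group_hom_axioms_def group_D GT.is_group)
  have C_eq: "C_group = ?GT\<lparr>carrier := ?q ` carrier D_group\<rparr>"
    unfolding dir_C_def by (simp add: image_def Bex_def conj_commute) 
  have group: "group C_group"
    unfolding C_eq by (rule GT.subgroup_imp_group[OF q.img_is_subgroup])
  have onto: "?q ` carrier D_group = carrier C_group" by (simp add: C_eq)
  have hom: "?q \<in> hom D_group C_group"
    using q.homh onto by (auto simp: hom_def dir_C_def)
  have C_norm: "C_norm = (\<lambda>h. Inf {D_norm w | w. w \<in> carrier D_group \<and> ?q w = h})"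
    by (rule ext) (simp only: dir_C_norm_def)
  show "norm_quotient_map D_group D_norm C_group C_norm ?q"
    unfolding C_norm by (rule DN.infimum_norm_quotient_map[OF group hom onto])
  show "conj_inv_pseudonormed_group C_group C_norm"
    unfolding C_norm by (rule DN.infimum_norm_pseudonormed[OF group hom onto])
qed

lemma dir_cone_complete_length_space:
  fixes K n
  defines "K \<equiv> dir_cone G N T" and "n \<equiv> dir_cone_norm G N T"
  shows "conj_inv_normed_group K n \<and> Metric_space.mcomplete (carrier K) (norm_dist K n) \<and>
    length_space (carrier K) (norm_dist K n)"
proof -
  interpret C: conj_inv_pseudonormed_group C_group C_norm by (rule dir_C_pseudonormed)
  have K: "K = C_group Mod C.null_elements" "n = (\<lambda>X. the_elem (C_norm ` X))"
    by (simp_all add: K_def n_def dir_cone_def C.null_elements_def dir_cone_norm_def fun_eq_iff)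
  interpret K: conj_inv_normed_group K n
    unfolding K by (rule C.quotient_conj_inv_normed_group)
  have quot: "norm_quotient_map D_group D_norm K n ((\<lambda>g. C.null_elements #>\<^bsub>C_group\<^esub> g) \<circ> compose T (FZ_pi G))"
    unfolding K by (rule norm_quotient_map_comp[OF dir_C_norm_quotient_map C.norm_quotient_map_coset])
  have "fast_products_converge K n"
    by (rule fast_products_converge_quotient[OF D_norm_pseudonormed _ quot D_fast_products_converge]) unfold_locales
  then have complete: "Metric_space.mcomplete (carrier K) (norm_dist K n)"
    by (rule K.mcomplete_if_fast_products_converge)
  have "has_almost_geodesics K n"
    by (rule has_almost_geodesics_quotient[OF D_norm_pseudonormed _ quot D_has_almost_geodesics])
      unfold_locales
  then show ?thesis
    using complete K.length_space_if_has_almost_geodesics K.conj_inv_normed_group_axioms by blast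
qed

end

theorem theorem1p4:
  fixes G :: "('a, 'b) monoid_scheme" and N :: "'a \<Rightarrow> real" and T :: "real set"
  assumes "conj_inv_normed_group G N"
    and "scaling_set T"
  shows "(Metric_space (carrier (dir_cone G N T)) (dir_cone_dist G N T) \<and>
          Metric_space.mcomplete (carrier (dir_cone G N T)) (dir_cone_dist G N T)) \<and>
         length_space (carrier (dir_cone G N T)) (dir_cone_dist G N T)"
proof -
  interpret scaled_normed_group G N T
    using assms by (simp add: scaled_normed_group_def scaled_normed_group_axioms_def)
  show ?thesis
    using dir_cone_complete_length_space conj_inv_normed_group.Metric_space_norm_dist
    unfolding dir_cone_dist_def by blast
qed

end
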